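(* Let $E$ and $F$ be compact topological graphs. Suppose that $X(E)\cong X(F)$ as Hilbert bimodules. Then $E$ and $F$ are locally conjugate.
   Context: A topological graph is a quadruple $E=(E^0,E^1,r_E,s_E)$ where $E^0,E^1$ are locally compact Hausdorff spaces, $r_E:E^1\to E^0$ is continuous and $s_E:E^1\to E^0$ is a local homeomorphism; it is compact if $E^0$ and $E^1$ are compact. For $U\subseteq E^0$, $E^1U:=s_E^{-1}(U)$. For $E$ compact, the graph correspondence $X(E)$ is the right-Hilbert $C(E^0)$-bimodule ($C^*$-correspondence over $C(E^0)$) which is $C(E^1)$ as a vector space, with $(x\cdot\alpha)(e)=x(e)\alpha(s_E(e))$, $(\alpha\cdot x)(e)=\alpha(r_E(e))x(e)$ and $\langle x,y\rangle_{C(E^0)}(v)=\sum_{s_E(e)=v}\overline{x(e)}y(e)$ (empty sums are $0$). $X(E)\cong X(F)$ as Hilbert bimodules means there are a $*$-isomorphism $\theta^0$ between $C(E^0)$ and $C(F^0)$ and a linear bijection $\theta^1$ between $X(E)$ and $X(F)$ (in the same direction) that respect the left actions, right actions and inner products. $E$ and $F$ are locally conjugate if there exists a homeomorphism $\phi^0:E^0\to F^0$ such that for each $v\in E^0$ there are a neighborhood $U$ of $v$ and a homeomorphism $\phi^1_U:E^1U\to F^1\phi^0(U)$ such that $r_F\circ\phi^1_U=\phi^0\circ r_E|_{E^1U}$ and $s_F\circ\phi^1_U=\phi^0\circ s_E|_{E^1U}$. *)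

theory Defs
  imports "HOL-Analysis.Analysis"
begin

section \<open>Topological graphs\<close>

text \<open>Spaces are values of type \<open>'a topology\<close>, not types of a topological class, so that
  \<open>E\<^sup>0\<close> and \<open>E\<^sup>1\<close> may be empty. The maps are total functions, of which only the restriction to the
  edge space matters.\<close>

record ('v, 'e) top_graph =
  verts :: "'v topology"
  edges :: "'e topology"
  rng :: "'e \<Rightarrow> 'v"
  src :: "'e \<Rightarrow> 'v"

definition local_homeomorphism :: "'a topology \<Rightarrow> 'b topology \<Rightarrow> ('a \<Rightarrow> 'b) \<Rightarrow> bool" where
  "local_homeomorphism X Y f \<longleftrightarrow>
     (\<forall>x\<in>topspace X. \<exists>U. openin X U \<and> x \<in> U \<and> openin Y (f ` U) \<and>
        homeomorphic_map (subtopology X U) (subtopology Y (f ` U)) f)"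

definition topological_graph :: "('v, 'e) top_graph \<Rightarrow> bool" where
  "topological_graph E \<longleftrightarrow>
     locally_compact_space (verts E) \<and> Hausdorff_space (verts E) \<and>
     locally_compact_space (edges E) \<and> Hausdorff_space (edges E) \<and>
     continuous_map (edges E) (verts E) (rng E) \<and>
     local_homeomorphism (edges E) (verts E) (src E)"

definition compact_topological_graph :: "('v, 'e) top_graph \<Rightarrow> bool" where
  "compact_topological_graph E \<longleftrightarrow>
     topological_graph E \<and> compact_space (verts E) \<and> compact_space (edges E)"

definition edges_from :: "('v, 'e) top_graph \<Rightarrow> 'v set \<Rightarrow> 'e set" where
  "edges_from E U = {e \<in> topspace (edges E). src E e \<in> U}"


section \<open>Complex *-algebras and Hilbert bimodules\<close>

text \<open>These records only carry the operations that an isomorphism has to respect.\<close>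

record 'a star_alg =
  alg_carrier :: "'a set"
  alg_add :: "'a \<Rightarrow> 'a \<Rightarrow> 'a"
  alg_scale :: "complex \<Rightarrow> 'a \<Rightarrow> 'a"
  alg_mult :: "'a \<Rightarrow> 'a \<Rightarrow> 'a"
  alg_star :: "'a \<Rightarrow> 'a"

record ('a, 'x) hilbert_bimod =
  coeff_alg :: "'a star_alg"
  mod_carrier :: "'x set"
  mod_add :: "'x \<Rightarrow> 'x \<Rightarrow> 'x"
  mod_scale :: "complex \<Rightarrow> 'x \<Rightarrow> 'x"
  left_act :: "'a \<Rightarrow> 'x \<Rightarrow> 'x"
  right_act :: "'x \<Rightarrow> 'a \<Rightarrow> 'x"
  inner_prod :: "'x \<Rightarrow> 'x \<Rightarrow> 'a"

definition star_isomorphism :: "'a star_alg \<Rightarrow> 'b star_alg \<Rightarrow> ('a \<Rightarrow> 'b) \<Rightarrow> bool" where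
  "star_isomorphism A B \<theta> \<longleftrightarrow>
     bij_betw \<theta> (alg_carrier A) (alg_carrier B) \<and>
     (\<forall>a\<in>alg_carrier A. \<forall>b\<in>alg_carrier A. \<theta> (alg_add A a b) = alg_add B (\<theta> a) (\<theta> b)) \<and>
     (\<forall>c. \<forall>a\<in>alg_carrier A. \<theta> (alg_scale A c a) = alg_scale B c (\<theta> a)) \<and>
     (\<forall>a\<in>alg_carrier A. \<forall>b\<in>alg_carrier A. \<theta> (alg_mult A a b) = alg_mult B (\<theta> a) (\<theta> b)) \<and>
     (\<forall>a\<in>alg_carrier A. \<theta> (alg_star A a) = alg_star B (\<theta> a))"

definition linear_bijection ::
    "('a, 'x) hilbert_bimod \<Rightarrow> ('b, 'y) hilbert_bimod \<Rightarrow> ('x \<Rightarrow> 'y) \<Rightarrow> bool" where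
  "linear_bijection X Y \<theta> \<longleftrightarrow>
     bij_betw \<theta> (mod_carrier X) (mod_carrier Y) \<and>
     (\<forall>x\<in>mod_carrier X. \<forall>y\<in>mod_carrier X. \<theta> (mod_add X x y) = mod_add Y (\<theta> x) (\<theta> y)) \<and>
     (\<forall>c. \<forall>x\<in>mod_carrier X. \<theta> (mod_scale X c x) = mod_scale Y c (\<theta> x))"

definition hilbert_bimod_isomorphic ::
    "('a, 'x) hilbert_bimod \<Rightarrow> ('b, 'y) hilbert_bimod \<Rightarrow> bool" where
  "hilbert_bimod_isomorphic X Y \<longleftrightarrow>
     (\<exists>\<theta>0 \<theta>1. star_isomorphism (coeff_alg X) (coeff_alg Y) \<theta>0 \<and> linear_bijection X Y \<theta>1 \<and>
        (\<forall>a\<in>alg_carrier (coeff_alg X). \<forall>x\<in>mod_carrier X.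
           \<theta>1 (left_act X a x) = left_act Y (\<theta>0 a) (\<theta>1 x) \<and>
           \<theta>1 (right_act X x a) = right_act Y (\<theta>1 x) (\<theta>0 a)) \<and>
        (\<forall>x\<in>mod_carrier X. \<forall>y\<in>mod_carrier X.
           inner_prod Y (\<theta>1 x) (\<theta>1 y) = \<theta>0 (inner_prod X x y)))"


section \<open>The algebra of continuous functions and the graph correspondence\<close>

text \<open>A function on a space is represented by its extensional representative, i.e. the one that
  takes the value \<^const>\<open>undefined\<close> outside the space, so that equality of elements is equality of
  functions on the space.\<close>

definition cont_funs :: "'a topology \<Rightarrow> ('a \<Rightarrow> complex) set" where
  "cont_funs X = {f \<in> extensional (topspace X). continuous_map X euclidean f}"

definition cont_alg :: "'a topology \<Rightarrow> ('a \<Rightarrow> complex) star_alg" where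
  "cont_alg X =
     \<lparr>alg_carrier = cont_funs X,
      alg_add = (\<lambda>f g. \<lambda>p\<in>topspace X. f p + g p),
      alg_scale = (\<lambda>c f. \<lambda>p\<in>topspace X. c * f p),
      alg_mult = (\<lambda>f g. \<lambda>p\<in>topspace X. f p * g p),
      alg_star = (\<lambda>f. \<lambda>p\<in>topspace X. cnj (f p))\<rparr>"

text \<open>The sum in the inner product is over a finite set when \<open>E\<close> is compact: the fibres of the
  source map are then compact and discrete.\<close>

definition graph_correspondence ::
    "('v, 'e) top_graph \<Rightarrow> ('v \<Rightarrow> complex, 'e \<Rightarrow> complex) hilbert_bimod" where
  "graph_correspondence E =
     \<lparr>coeff_alg = cont_alg (verts E),
      mod_carrier = cont_funs (edges E),
      mod_add = (\<lambda>x y. \<lambda>e\<in>topspace (edges E). x e + y e),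
      mod_scale = (\<lambda>c x. \<lambda>e\<in>topspace (edges E). c * x e),
      left_act = (\<lambda>\<alpha> x. \<lambda>e\<in>topspace (edges E). \<alpha> (rng E e) * x e),
      right_act = (\<lambda>x \<alpha>. \<lambda>e\<in>topspace (edges E). x e * \<alpha> (src E e)),
      inner_prod = (\<lambda>x y. \<lambda>v\<in>topspace (verts E).
        \<Sum>e\<in>{e \<in> topspace (edges E). src E e = v}. cnj (x e) * y e)\<rparr>"


section \<open>Local conjugacy\<close>

text \<open>The neighbourhood \<open>U\<close> need not be open.\<close>

definition locally_conjugate :: "('v, 'e) top_graph \<Rightarrow> ('w, 'f) top_graph \<Rightarrow> bool" where
  "locally_conjugate E F \<longleftrightarrow>
     (\<exists>\<phi>0. homeomorphic_map (verts E) (verts F) \<phi>0 \<and>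
        (\<forall>v\<in>topspace (verts E). \<exists>U \<phi>1.
           U \<subseteq> topspace (verts E) \<and> v \<in> verts E interior_of U \<and>
           homeomorphic_map (subtopology (edges E) (edges_from E U))
             (subtopology (edges F) (edges_from F (\<phi>0 ` U))) \<phi>1 \<and>
           (\<forall>e\<in>edges_from E U. rng F (\<phi>1 e) = \<phi>0 (rng E e) \<and> src F (\<phi>1 e) = \<phi>0 (src E e))))"

end

theory Submission
  imports Defs
begin


text \<open>
  A *-isomorphism of the coefficient algebras is composition with a homeomorphism \<open>\<phi>\<close> of the vertex
  spaces. Since the module isomorphism \<open>\<theta>\<close> preserves the inner product, the values of \<open>\<theta> x\<close> on the
  fibre of \<open>\<phi> v\<close> depend only on those of \<open>x\<close> on the fibre of \<open>v\<close>, which gives an invertible matrix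
  from one fibre to the other. By invertibility there is a bijection of the fibres along nonzero
  entries. The entries are continuous in \<open>v\<close>, so this bijection extends to the sheets over a
  neighbourhood of \<open>v\<close> with the entries still nonzero; and since \<open>\<theta>\<close> respects the left action, an
  entry can be nonzero only between edges whose ranges correspond under \<open>\<phi>\<close>.
\<close>

section \<open>Continuous functions on compact Hausdorff spaces\<close>

text \<open>On a fibre \<theta> acts as a unitary matrix, but a unitary matrix need not be a
  permutation matrix, so \<theta> itself does not match edges with edges. What survives is that the
  determinant of an invertible matrix has a nonzero term, that is, there is a bijection along
  nonzero entries. It is a choice made separately at each vertex, and the choices at different
  vertices need not fit together; hence the vertex homeomorphism is global while the edge
  homeomorphisms are only local. To pass from a fibre to its neighbours, the basis of the fibre is
  realised by bump functions \<open>x e\<close>, each supported in one sheet of the source map. The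
  same functions then probe all nearby fibres, and \<open>\<theta> (x e)\<close> is a continuous
  function on the edges of \<open>F\<close>, so being nonzero is an open condition.\<close>

lemma restrict_in_cont_funs:
  assumes "continuous_map X euclidean f"
  shows "restrict f (topspace X) \<in> cont_funs X"
  using assms by (auto simp: cont_funs_def intro: continuous_map_eq)

lemma cont_funs_continuous: "f \<in> cont_funs X \<Longrightarrow> continuous_map X euclidean f"
  by (simp add: cont_funs_def)

lemma continuous_map_complex_mult [continuous_intros]:
  fixes f g :: "'a \<Rightarrow> complex"
  shows "\<lbrakk>continuous_map X euclidean f; continuous_map X euclidean g\<rbrakk>
    \<Longrightarrow> continuous_map X euclidean (\<lambda>x. f x * g x)"
  by (simp add: continuous_map_atin tendsto_mult)

lemma continuous_map_complex_inverse:
  fixes f :: "'a \<Rightarrow> complex"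
  shows "\<lbrakk>continuous_map X euclidean f; \<And>x. x \<in> topspace X \<Longrightarrow> f x \<noteq> 0\<rbrakk>
    \<Longrightarrow> continuous_map X euclidean (\<lambda>x. inverse (f x))"
  by (simp add: continuous_map_atin tendsto_inverse)

lemma continuous_map_cnj [continuous_intros]:
  "continuous_map X euclidean f \<Longrightarrow> continuous_map X euclidean (\<lambda>x. cnj (f x))"
  by (simp add: continuous_map_atin tendsto_cnj)

lemma openin_nonzero_set:
  fixes f :: "'a \<Rightarrow> complex"
  assumes "continuous_map X euclidean f"
  shows "openin X {x \<in> topspace X. f x \<noteq> 0}"
  using openin_continuous_map_preimage[OF assms, of "- {0}"] by auto

lemma urysohn_bump:
  assumes "compact_space X" "Hausdorff_space X" "openin X W" "x \<in> W"
  obtains f where "f \<in> cont_funs X" "f x = 1" "\<And>p. p \<in> topspace X - W \<Longrightarrow> f p = 0"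
proof -
  have x: "x \<in> topspace X"
    using assms openin_subset by blast
  have "normal_space X"
    using assms compact_Hausdorff_or_regular_imp_normal_space by blast
  moreover have "closedin X {x}"
    using x assms by (simp add: closedin_Hausdorff_singleton)
  moreover have "closedin X (topspace X - W)"
    using assms by blast
  moreover have "disjnt {x} (topspace X - W)"
    using assms by (auto simp: disjnt_def)
  ultimately obtain g :: "'a \<Rightarrow> real" where g: "continuous_map X euclideanreal g"
      "g ` {x} \<subseteq> {1}" "g ` (topspace X - W) \<subseteq> {0}"
    by (rule Urysohn_lemma_alt)
  have "continuous_map X euclidean (complex_of_real \<circ> g)"
    by (rule continuous_map_compose[OF g(1)]) (auto intro: continuous_intros)
  from restrict_in_cont_funs[OF this] show thesis
    by (rule that) (use g x in auto)
qed

section \<open>Gelfand duality\<close>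

context
  fixes X :: "'a topology" and Y :: "'b topology" and \<theta> :: "('a \<Rightarrow> complex) \<Rightarrow> 'b \<Rightarrow> complex"
  assumes iso: "star_isomorphism (cont_alg X) (cont_alg Y) \<theta>"
begin

lemma star_iso_bij: "bij_betw \<theta> (cont_funs X) (cont_funs Y)"
  using iso by (simp add: star_isomorphism_def cont_alg_def)

lemma star_iso_pointwise:
  assumes "a \<in> cont_funs X" "b \<in> cont_funs X" "y \<in> topspace Y"
  shows "\<theta> (\<lambda>p\<in>topspace X. a p + b p) y = \<theta> a y + \<theta> b y"
    and "\<theta> (\<lambda>p\<in>topspace X. c * a p) y = c * \<theta> a y"
    and "\<theta> (\<lambda>p\<in>topspace X. a p * b p) y = \<theta> a y * \<theta> b y"
    and "\<theta> (\<lambda>p\<in>topspace X. cnj (a p)) y = cnj (\<theta> a y)"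
  using iso assms by (auto simp: star_isomorphism_def cont_alg_def)

text \<open>Preservation of the unit is not part of \<open>star_isomorphism\<close>. It follows from
  surjectivity: if \<open>b\<close> is sent to 1, then applying \<theta> to \<open>1 * b = b\<close>
  gives the claim.\<close>

lemma star_iso_one:
  assumes y: "y \<in> topspace Y"
  shows "\<theta> (\<lambda>p\<in>topspace X. 1) y = 1"
proof -
  have "(\<lambda>p\<in>topspace Y. 1) \<in> cont_funs Y"
    by (intro restrict_in_cont_funs) simp
  then obtain b where b: "b \<in> cont_funs X" "\<theta> b = (\<lambda>p\<in>topspace Y. 1)"
    using star_iso_bij unfolding bij_betw_def by (metis imageE)
  have one: "(\<lambda>p\<in>topspace X. 1) \<in> cont_funs X"
    by (intro restrict_in_cont_funs) simp
  have "(\<lambda>p\<in>topspace X. (\<lambda>p\<in>topspace X. 1) p * b p) = b"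
    using b(1) by (auto simp: cont_funs_def extensional_def fun_eq_iff)
  then show ?thesis
    using star_iso_pointwise(3)[OF one b(1) y] b(2) y by simp
qed

text \<open>The kernel of a character has a common zero: otherwise a finite sum of elements
  \<open>\<bar>a\<bar>\<^sup>2\<close> of the kernel would have no zero, and would be invertible.\<close>

lemma star_iso_eval_point:
  assumes X: "compact_space X" and y: "y \<in> topspace Y"
  obtains x where "x \<in> topspace X" "\<And>a. a \<in> cont_funs X \<Longrightarrow> \<theta> a y = a x"
proof -
  define K where "K = {a \<in> cont_funs X. \<theta> a y = 0}"
  have one: "(\<lambda>p\<in>topspace X. 1) \<in> cont_funs X"
    by (intro restrict_in_cont_funs) simp
  have zero: "\<exists>p\<in>topspace X. a p = 0" if a: "a \<in> K" for a
  proof (rule ccontr)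
    assume "\<not> ?thesis"
    then have nz: "\<And>p. p \<in> topspace X \<Longrightarrow> a p \<noteq> 0" by auto
    define b where "b = (\<lambda>p\<in>topspace X. inverse (a p))"
    have "b \<in> cont_funs X"
      unfolding b_def using a nz
      by (intro restrict_in_cont_funs continuous_map_complex_inverse)
        (auto simp: K_def cont_funs_continuous)
    moreover have "(\<lambda>p\<in>topspace X. a p * b p) = (\<lambda>p\<in>topspace X. 1)"
      using nz by (auto simp: b_def fun_eq_iff)
    ultimately show False
      using star_iso_pointwise(3)[of a b y] star_iso_one[OF y] a y by (simp add: K_def)
  qed
  have fin: "\<exists>a\<in>K. \<forall>p\<in>topspace X. a p = 0 \<longrightarrow> (\<forall>b\<in>S. b p = 0)" if "finite S" "S \<subseteq> K" for S
    using that
  proof (induction S)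
    case empty
    \<comment> \<open>The zero function is written as the multiple \<open>0 * 1\<close>, so that the
      scaling law places it in \<open>K\<close>.\<close>
    have "\<theta> (\<lambda>p\<in>topspace X. 0 * (\<lambda>p\<in>topspace X. 1) p) y = 0"
      using star_iso_pointwise(2)[OF one one y, of 0] by simp
    then have "(\<lambda>p\<in>topspace X. 0 * (\<lambda>p\<in>topspace X. 1) p) \<in> K"
      unfolding K_def by (auto intro: restrict_in_cont_funs)
    then show ?case by auto
  next
    case (insert b S)
    then obtain a where a: "a \<in> K" "\<And>p. p \<in> topspace X \<Longrightarrow> a p = 0 \<Longrightarrow> \<forall>b\<in>S. b p = 0"
      by auto
    have b: "b \<in> K" using insert by auto
    have sq: "(\<lambda>p\<in>topspace X. (\<lambda>p\<in>topspace X. cnj (a p)) p * a p) \<in> K" if "a \<in> K" for a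
    proof -
      have a: "a \<in> cont_funs X" "\<theta> a y = 0" using that by (auto simp: K_def)
      have c: "(\<lambda>p\<in>topspace X. cnj (a p)) \<in> cont_funs X"
        using a by (intro restrict_in_cont_funs continuous_intros cont_funs_continuous)
      have "(\<lambda>p\<in>topspace X. (\<lambda>p\<in>topspace X. cnj (a p)) p * a p) \<in> cont_funs X"
        using a c by (intro restrict_in_cont_funs continuous_intros cont_funs_continuous)
      then show ?thesis
        using star_iso_pointwise(3)[OF c a(1) y] a by (simp add: K_def)
    qed
    define A where "A = (\<lambda>p\<in>topspace X. (\<lambda>p\<in>topspace X. cnj (a p)) p * a p)"
    define B where "B = (\<lambda>p\<in>topspace X. (\<lambda>p\<in>topspace X. cnj (b p)) p * b p)"
    have AB: "A \<in> K" "B \<in> K" using sq a b by (auto simp: A_def B_def)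
    have "(\<lambda>p\<in>topspace X. A p + B p) \<in> cont_funs X"
      using AB by (intro restrict_in_cont_funs continuous_intros cont_funs_continuous)
        (auto simp: K_def)
    then have "(\<lambda>p\<in>topspace X. A p + B p) \<in> K"
      using star_iso_pointwise(1)[of A B y] AB y by (simp add: K_def)
    moreover have "a p = 0 \<and> b p = 0" if "A p + B p = 0" "p \<in> topspace X" for p
    proof -
      have "complex_of_real ((cmod (a p))\<^sup>2 + (cmod (b p))\<^sup>2) = A p + B p"
        using that unfolding A_def B_def
        by (simp add: complex_norm_square mult.commute del: of_real_power)
      then show ?thesis
        using that by (simp add: sum_power2_eq_zero_iff flip: of_real_power of_real_add)
    qed
    ultimately show ?case
      using a by (intro bexI[of _ "\<lambda>p\<in>topspace X. A p + B p"]) auto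
  qed
  have "\<exists>x\<in>topspace X. \<forall>a\<in>K. a x = 0"
  proof (rule ccontr)
    assume "\<not> ?thesis"
    then have "topspace X \<subseteq> (\<Union>a\<in>K. {p \<in> topspace X. a p \<noteq> 0})" by auto
    moreover have "\<forall>U \<in> (\<lambda>a. {p \<in> topspace X. a p \<noteq> 0}) ` K. openin X U"
      by (auto simp: K_def intro: openin_nonzero_set cont_funs_continuous)
    ultimately obtain \<F> where \<F>: "finite \<F>" "\<F> \<subseteq> (\<lambda>a. {p \<in> topspace X. a p \<noteq> 0}) ` K"
        "topspace X \<subseteq> \<Union>\<F>"
      using X unfolding compact_space_alt by meson
    then obtain S where "finite S" "S \<subseteq> K" "\<F> = (\<lambda>a. {p \<in> topspace X. a p \<noteq> 0}) ` S"
      by (meson finite_subset_image)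
    with fin[of S] obtain a where a: "a \<in> K" "\<forall>p\<in>topspace X. a p = 0 \<longrightarrow> (\<forall>b\<in>S. b p = 0)"
      by blast
    from zero[OF a(1)] obtain p where p: "p \<in> topspace X" "a p = 0" by blast
    then have "\<forall>b\<in>S. b p = 0" using a(2) by blast
    then have "p \<notin> \<Union>\<F>"
      using \<open>\<F> = _\<close> by simp
    then show False using p(1) \<F>(3) by blast
  qed
  then obtain x where x: "x \<in> topspace X" "\<And>a. a \<in> K \<Longrightarrow> a x = 0" by auto
  have "\<theta> a y = a x" if a: "a \<in> cont_funs X" for a
  proof -
    \<comment> \<open>Adding \<open>u\<close> subtracts the constant \<open>\<theta> a y\<close>
      from \<open>a\<close>. The difference lies in the kernel \<open>K\<close>, hence vanishes at
      the common zero \<open>x\<close>.\<close>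
    define u where "u = (\<lambda>p\<in>topspace X. (- \<theta> a y) * (\<lambda>p\<in>topspace X. 1) p)"
    have u: "u \<in> cont_funs X" unfolding u_def
      by (intro restrict_in_cont_funs continuous_intros cont_funs_continuous one) auto
    have "(\<lambda>p\<in>topspace X. a p + u p) \<in> cont_funs X"
      using a u by (intro restrict_in_cont_funs continuous_intros cont_funs_continuous)
    moreover have "\<theta> (\<lambda>p\<in>topspace X. a p + u p) y = 0"
      using star_iso_pointwise(1)[OF a u y] star_iso_pointwise(2)[OF one one y, of "- \<theta> a y"]
        star_iso_one[OF y] by (simp add: u_def)
    ultimately have "(\<lambda>p\<in>topspace X. a p + u p) \<in> K" by (simp add: K_def)
    from x(2)[OF this] x(1) show ?thesis by (simp add: u_def)
  qed
  with x(1) show thesis by (rule that)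
qed

text \<open>Evaluation at \<open>y\<close> after \<theta> is evaluation at a point
  \<open>\<psi> y\<close>, so the natural map \<psi> runs backwards and \<phi> is its inverse.
  Continuity of \<psi> holds because the nonvanishing sets of continuous functions form a base of
  the topology. Surjectivity of \<theta> makes \<psi> injective, since functions separate the points
  of \<open>Y\<close>; injectivity of \<theta> makes \<psi> surjective.\<close>

lemma star_iso_homeomorphism:
  assumes X: "compact_space X" "Hausdorff_space X" and Y: "compact_space Y" "Hausdorff_space Y"
  obtains \<phi> where "homeomorphic_map X Y \<phi>"
    "\<And>a x. a \<in> cont_funs X \<Longrightarrow> x \<in> topspace X \<Longrightarrow> \<theta> a (\<phi> x) = a x"
proof -
  have "\<forall>y\<in>topspace Y. \<exists>x\<in>topspace X. \<forall>a\<in>cont_funs X. \<theta> a y = a x"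
    using star_iso_eval_point[OF X(1)] by metis
  then obtain \<psi> where \<psi>: "\<And>y. y \<in> topspace Y \<Longrightarrow> \<psi> y \<in> topspace X"
      "\<And>a y. y \<in> topspace Y \<Longrightarrow> a \<in> cont_funs X \<Longrightarrow> \<theta> a y = a (\<psi> y)"
    by metis
  have \<theta>_in: "\<theta> a \<in> cont_funs Y" if "a \<in> cont_funs X" for a
    using that star_iso_bij by (auto simp: bij_betw_def)
  have cont: "continuous_map Y X \<psi>"
    unfolding continuous_map_def
  proof (intro conjI allI impI)
    fix W assume W: "openin X W"
    show "openin Y {y \<in> topspace Y. \<psi> y \<in> W}"
    proof (subst openin_subopen, intro ballI)
      fix y assume y: "y \<in> {y \<in> topspace Y. \<psi> y \<in> W}"
      then obtain a where a: "a \<in> cont_funs X" "a (\<psi> y) = 1"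
          "\<And>p. p \<in> topspace X - W \<Longrightarrow> a p = 0"
        using urysohn_bump[OF X W, of "\<psi> y"] by blast
      have "openin Y {y \<in> topspace Y. \<theta> a y \<noteq> 0}"
        by (intro openin_nonzero_set cont_funs_continuous \<theta>_in a)
      moreover have "{y \<in> topspace Y. \<theta> a y \<noteq> 0} \<subseteq> {y \<in> topspace Y. \<psi> y \<in> W}"
      proof clarify
        fix z assume z: "z \<in> topspace Y" "\<theta> a z \<noteq> 0"
        then show "\<psi> z \<in> W" using \<psi>(1)[of z] \<psi>(2)[of z a] a(1) a(3)[of "\<psi> z"] by auto
      qed
      ultimately show "\<exists>T. openin Y T \<and> y \<in> T \<and> T \<subseteq> {y \<in> topspace Y. \<psi> y \<in> W}"
        using \<psi>(2)[of y a] y a by (intro exI[of _ "{y \<in> topspace Y. \<theta> a y \<noteq> 0}"]) auto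
    qed
  qed (use \<psi> in auto)
  have inj: "inj_on \<psi> (topspace Y)"
  proof (rule inj_onI, rule ccontr)
    fix y z assume yz: "y \<in> topspace Y" "z \<in> topspace Y" "\<psi> y = \<psi> z" "y \<noteq> z"
    have "openin Y (topspace Y - {z})"
      using Y yz by (simp add: closedin_Hausdorff_singleton openin_diff)
    then obtain b where b: "b \<in> cont_funs Y" "b y = 1" "b z = 0"
      using urysohn_bump[OF Y, of "topspace Y - {z}" y] yz by auto
    then obtain a where "a \<in> cont_funs X" "b = \<theta> a"
      using star_iso_bij by (auto simp: bij_betw_def)
    then show False using b \<psi>(2)[of y a] \<psi>(2)[of z a] yz by simp
  qed
  have surj: "\<psi> ` topspace Y = topspace X"
  proof (rule ccontr)
    assume "\<not> ?thesis"
    then obtain x where x: "x \<in> topspace X" "x \<notin> \<psi> ` topspace Y" using \<psi> by auto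
    have "closedin X (\<psi> ` topspace Y)"
      using continuous_imp_closed_map[OF cont Y(1) X(2)] by (auto simp: closed_map_def)
    then have "openin X (topspace X - \<psi> ` topspace Y)" by blast
    from urysohn_bump[OF X this, of x] x
    obtain a where a: "a \<in> cont_funs X" "a x = 1"
        and a0: "\<And>p. p \<in> topspace X - (topspace X - \<psi> ` topspace Y) \<Longrightarrow> a p = 0"
      by blast
    \<comment> \<open>\<open>z\<close> is the zero function. As \<open>a\<close> vanishes on the
      image of \<psi>, it has the same image under \<theta> as \<open>z\<close>, although
      \<open>a x = 1\<close>.\<close>
    define z where "z = (\<lambda>p\<in>topspace X. 0 * a p)"
    have z: "z \<in> cont_funs X" unfolding z_def
      using a by (intro restrict_in_cont_funs continuous_intros cont_funs_continuous) auto
    have "\<theta> a y = \<theta> z y" if "y \<in> topspace Y" for y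
      using \<psi>(2)[OF that a(1)] \<psi>(2)[OF that z] that a0[of "\<psi> y"] \<psi>(1)[OF that]
      by (simp add: z_def)
    then have "\<theta> a = \<theta> z"
      using \<theta>_in[OF a(1)] \<theta>_in[OF z] by (auto simp: cont_funs_def intro: extensionalityI)
    then have "a = z" using star_iso_bij a z by (auto simp: bij_betw_def inj_on_def)
    then show False using a x by (simp add: z_def)
  qed
  have "homeomorphic_map Y X \<psi>"
    by (rule continuous_imp_homeomorphic_map[OF cont Y(1) X(2) surj inj])
  then obtain \<phi> where \<phi>: "homeomorphic_maps Y X \<psi> \<phi>"
    using homeomorphic_map_maps by blast
  then have h: "homeomorphic_map X Y \<phi>" "\<And>x. x \<in> topspace X \<Longrightarrow> \<psi> (\<phi> x) = x"
    by (auto simp: homeomorphic_maps_map)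
  have "\<theta> a (\<phi> x) = a x" if "a \<in> cont_funs X" "x \<in> topspace X" for a x
  proof -
    have "\<phi> x \<in> topspace Y"
      using homeomorphic_imp_surjective_map[OF h(1)] that(2) by blast
    from \<psi>(2)[OF this that(1)] h(2)[OF that(2)] show ?thesis by simp
  qed
  with h(1) show thesis by (rule that)
qed

end

section \<open>Linear algebra\<close>

text \<open>Induction step: if deleting a row \<open>r\<close> with \<open>M r k \<noteq> 0\<close> always made the other columns
  dependent, every such unit vector would lie in their span, hence so would column \<open>k\<close>.\<close>

lemma independent_columns_transversal:
  fixes M :: "'i \<Rightarrow> 'j \<Rightarrow> 'k::field"
  assumes "finite J" "finite I"
    and "\<And>c. \<forall>i\<in>I. (\<Sum>j\<in>J. c j * M i j) = 0 \<Longrightarrow> \<forall>j\<in>J. c j = 0"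
  shows "\<exists>\<sigma>. inj_on \<sigma> J \<and> \<sigma> ` J \<subseteq> I \<and> (\<forall>j\<in>J. M (\<sigma> j) j \<noteq> 0)"
  using assms
proof (induction J arbitrary: I)
  case empty
  then show ?case by auto
next
  case (insert k J)
  note ind = insert.prems(2)
  have "\<exists>r\<in>I. M r k \<noteq> 0 \<and>
      (\<forall>c. (\<forall>i\<in>I - {r}. (\<Sum>j\<in>J. c j * M i j) = 0) \<longrightarrow> (\<forall>j\<in>J. c j = 0))"
  proof (rule ccontr)
    assume neg: "\<not> ?thesis"
    have "\<forall>r\<in>I. \<exists>d. \<forall>i\<in>I. (\<Sum>j\<in>J. d j * M i j) = (if i = r then M r k else 0)"
    proof
      fix r assume r: "r \<in> I"
      show "\<exists>d. \<forall>i\<in>I. (\<Sum>j\<in>J. d j * M i j) = (if i = r then M r k else 0)"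
      proof (cases "M r k = 0")
        case True
        then show ?thesis by (intro exI[of _ "\<lambda>_. 0"]) auto
      next
        case False
        with neg r obtain c l where c: "\<And>i. i \<in> I - {r} \<Longrightarrow> (\<Sum>j\<in>J. c j * M i j) = 0"
            "l \<in> J" "c l \<noteq> 0" by blast
        \<comment> \<open>In the combination with coefficients \<open>c\<close>, only the entry
          \<open>t\<close> in row \<open>r\<close> can be nonzero. It must be nonzero: otherwise
          \<open>c\<close>, extended by 0 at \<open>k\<close>, would be a dependence among all
          columns. The factor \<open>M r k / t\<close> then produces the required entry in row
          \<open>r\<close>.\<close>
        define t where "t = (\<Sum>j\<in>J. c j * M r j)"
        have "t \<noteq> 0"
        proof
          assume t0: "t = 0"
          have "(\<Sum>j\<in>insert k J. (c(k := 0)) j * M i j) = (\<Sum>j\<in>J. c j * M i j)" for i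
            using insert.hyps by (auto intro!: sum.cong)
          then have "\<forall>i\<in>I. (\<Sum>j\<in>insert k J. (c(k := 0)) j * M i j) = 0"
            using c(1) t0 by (auto simp: t_def)
          from ind[OF this] have "(c(k := 0)) l = 0" using c(2) by blast
          then show False using c insert.hyps by (simp split: if_splits)
        qed
        have eq: "(\<Sum>j\<in>J. M r k / t * c j * M i j) = M r k / t * (\<Sum>j\<in>J. c j * M i j)" for i
          by (simp only: sum_distrib_left mult.assoc)
        have "(\<Sum>j\<in>J. M r k / t * c j * M i j) = (if i = r then M r k else 0)" if "i \<in> I" for i
          unfolding eq using c(1)[of i] that \<open>t \<noteq> 0\<close>
          by (cases "i = r") (simp_all flip: t_def)
        then show ?thesis by (intro exI[of _ "\<lambda>j. M r k / t * c j"] ballI)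
      qed
    qed
    from bchoice[OF this] obtain d where d: "\<And>r i. r \<in> I \<Longrightarrow> i \<in> I \<Longrightarrow>
        (\<Sum>j\<in>J. d r j * M i j) = (if i = r then M r k else 0)"
      by blast
    \<comment> \<open>The combinations with coefficients \<open>d r\<close> add up to column
      \<open>k\<close>, so the coefficient \<open>-1\<close> at \<open>k\<close> yields a forbidden
      dependence.\<close>
    define c where "c = (\<lambda>j. \<Sum>r\<in>I. d r j)(k := - 1)"
    have "(\<Sum>j\<in>insert k J. c j * M i j) = 0" if i: "i \<in> I" for i
    proof -
      have "(\<Sum>j\<in>J. c j * M i j) = (\<Sum>j\<in>J. \<Sum>r\<in>I. d r j * M i j)"
        using insert.hyps by (auto simp: c_def sum_distrib_right intro!: sum.cong)
      also have "\<dots> = (\<Sum>r\<in>I. \<Sum>j\<in>J. d r j * M i j)" by (rule sum.swap)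
      also have "\<dots> = M i k"
        using d i insert.prems(1) by simp
      finally show ?thesis using insert.hyps by (simp add: c_def)
    qed
    with ind[of c] have "c k = 0" by blast
    then show False by (simp add: c_def)
  qed
  then obtain r where r: "r \<in> I" "M r k \<noteq> 0"
      "\<And>c. \<forall>i\<in>I - {r}. (\<Sum>j\<in>J. c j * M i j) = 0 \<Longrightarrow> \<forall>j\<in>J. c j = 0" by blast
  obtain \<sigma> where \<sigma>: "inj_on \<sigma> J" "\<sigma> ` J \<subseteq> I - {r}" "\<forall>j\<in>J. M (\<sigma> j) j \<noteq> 0"
    using insert.IH[of "I - {r}"] r(3) insert.prems(1) by auto
  show ?case
    using \<sigma> r insert.hyps by (intro exI[of _ "\<sigma>(k := r)"]) (auto simp: inj_on_def)
qed

section \<open>Local homeomorphisms of compact spaces\<close>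

lemma local_homeomorphism_facts:
  assumes "local_homeomorphism X Y f"
  shows local_homeomorphism_continuous: "continuous_map X Y f"
    and local_homeomorphism_open_map: "open_map X Y f"
    and local_homeomorphism_locally_inj:
      "\<And>x. x \<in> topspace X \<Longrightarrow> \<exists>U. openin X U \<and> x \<in> U \<and> inj_on f U"
proof -
  have loc: "\<exists>U. openin X U \<and> x \<in> U \<and> openin Y (f ` U) \<and> U \<subseteq> topspace X \<and> inj_on f U \<and>
      continuous_map (subtopology X U) Y f \<and> open_map (subtopology X U) (subtopology Y (f ` U)) f"
    if x: "x \<in> topspace X" for x
  proof -
    obtain U where U: "openin X U" "x \<in> U" "openin Y (f ` U)"
        "homeomorphic_map (subtopology X U) (subtopology Y (f ` U)) f"
      using assms x unfolding local_homeomorphism_def by blast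
    then have "U \<subseteq> topspace X" using openin_subset by blast
    with U homeomorphic_imp_injective_map[OF U(4)] homeomorphic_imp_continuous_map[OF U(4)]
      homeomorphic_imp_open_map[OF U(4)]
    show ?thesis
      by (intro exI[of _ U]) (auto simp: continuous_map_in_subtopology Int_absorb1)
  qed
  then show "\<And>x. x \<in> topspace X \<Longrightarrow> \<exists>U. openin X U \<and> x \<in> U \<and> inj_on f U" by blast
  show "continuous_map X Y f"
    unfolding continuous_map_def
  proof (intro conjI allI impI)
    show "f \<in> topspace X \<rightarrow> topspace Y"
      using loc openin_subset by fastforce
    fix W assume W: "openin Y W"
    show "openin X {x \<in> topspace X. f x \<in> W}"
    proof (subst openin_subopen, intro ballI)
      fix x assume x: "x \<in> {x \<in> topspace X. f x \<in> W}"
      then obtain U where U: "openin X U" "x \<in> U" "U \<subseteq> topspace X"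
          "continuous_map (subtopology X U) Y f" using loc by blast
      then have "openin X {x \<in> U. f x \<in> W}"
        using openin_continuous_map_preimage[OF U(4) W] openin_open_subtopology[OF U(1)]
        by (simp add: Int_absorb1)
      then show "\<exists>T. openin X T \<and> x \<in> T \<and> T \<subseteq> {x \<in> topspace X. f x \<in> W}"
        using x U by (intro exI[of _ "{x \<in> U. f x \<in> W}"]) auto
    qed
  qed
  show "open_map X Y f"
    unfolding open_map_def
  proof (intro allI impI)
    fix W assume W: "openin X W"
    show "openin Y (f ` W)"
    proof (subst openin_subopen, intro ballI)
      fix y assume "y \<in> f ` W"
      then obtain x where x: "x \<in> W" "y = f x" by auto
      then obtain U where U: "openin X U" "x \<in> U" "openin Y (f ` U)"
          "open_map (subtopology X U) (subtopology Y (f ` U)) f"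
        using loc openin_subset[OF W] by blast
      have "openin (subtopology X U) (W \<inter> U)"
        using W by (auto simp: openin_subtopology)
      then have "openin Y (f ` (W \<inter> U))"
        using U(4) openin_open_subtopology[OF U(3)] by (auto simp: open_map_def)
      then show "\<exists>T. openin Y T \<and> y \<in> T \<and> T \<subseteq> f ` W"
        using x U by (intro exI[of _ "f ` (W \<inter> U)"]) auto
    qed
  qed
qed

section \<open>Finite fibres and the sheets around them\<close>

text \<open>Finitely many open sets on which \<open>p\<close> is injective cover \<open>X\<close>,
  and each of them meets the fibre in at most one point.\<close>

lemma finite_fibre:
  assumes "compact_space X" and lh: "local_homeomorphism X Y p"
  shows "finite {x \<in> topspace X. p x = v}"
proof -
  let ?\<U> = "{U. openin X U \<and> inj_on p U}"
  have "topspace X \<subseteq> \<Union>?\<U>"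
    using local_homeomorphism_locally_inj[OF lh] by blast
  then obtain \<F> where \<F>: "finite \<F>" "\<F> \<subseteq> ?\<U>" "topspace X \<subseteq> \<Union>\<F>"
    using assms(1) unfolding compact_space_alt by (metis (no_types, lifting) mem_Collect_eq)
  have "finite {x \<in> U. p x = v}" if "U \<in> \<F>" for U
  proof -
    have "inj_on p {x \<in> U. p x = v}"
      using \<F>(2) that by (auto simp: inj_on_def)
    moreover have "finite (p ` {x \<in> U. p x = v})"
      by (rule finite_subset[of _ "{v}"]) auto
    ultimately show ?thesis by (rule finite_imageD[rotated])
  qed
  then have "finite (\<Union>U\<in>\<F>. {x \<in> U. p x = v})"
    using \<F>(1) by blast
  then show ?thesis
    by (rule finite_subset[rotated]) (use \<F>(3) in auto)
qed

lemma Hausdorff_space_disjoint_nbhds: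
  assumes "Hausdorff_space X" "finite S" "S \<subseteq> topspace X"
  obtains W where "\<And>e. e \<in> S \<Longrightarrow> openin X (W e)" "\<And>e. e \<in> S \<Longrightarrow> e \<in> W e"
    "\<And>e e'. \<lbrakk>e \<in> S; e' \<in> S; e \<noteq> e'\<rbrakk> \<Longrightarrow> disjnt (W e) (W e')"
proof -
  have "\<forall>e e'. \<exists>U V. e \<in> S \<longrightarrow> e' \<in> S \<longrightarrow> e \<noteq> e' \<longrightarrow>
      openin X U \<and> openin X V \<and> e \<in> U \<and> e' \<in> V \<and> disjnt U V"
    using assms(1,3) unfolding Hausdorff_space_def by (metis subsetD)
  then obtain A B where AB: "\<And>e e'. \<lbrakk>e \<in> S; e' \<in> S; e \<noteq> e'\<rbrakk> \<Longrightarrow>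
      openin X (A e e') \<and> openin X (B e e') \<and> e \<in> A e e' \<and> e' \<in> B e e' \<and> disjnt (A e e') (B e e')"
    by metis
  \<comment> \<open>The chosen separation of a pair need not be symmetric, so \<open>W e\<close> is
    cut down by both choices: the one for \<open>(e, e')\<close> and the one for
    \<open>(e', e)\<close>. The factor \<open>topspace X\<close> covers the case of an empty
    intersection.\<close>
  define W where "W e = topspace X \<inter> (\<Inter>e'\<in>S - {e}. A e e' \<inter> B e' e)" for e
  show thesis
  proof
    show "openin X (W e)" if "e \<in> S" for e
    proof (cases "S - {e} = {}")
      case True
      show ?thesis unfolding W_def True by simp
    next
      case False
      have "openin X (\<Inter>e'\<in>S - {e}. A e e' \<inter> B e' e)"
        by (rule openin_INT2) (use False assms(2) AB that in auto)
      then show ?thesis by (auto simp: W_def)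
    qed
    show "e \<in> W e" if "e \<in> S" for e
      using AB that assms(3) by (auto simp: W_def)
    show "disjnt (W e) (W e')" if "e \<in> S" "e' \<in> S" "e \<noteq> e'" for e e'
      using AB[OF that] that by (fastforce simp: W_def disjnt_iff)
  qed
qed

lemma local_homeomorphism_sheets:
  assumes "compact_space X" "Hausdorff_space X" and lh: "local_homeomorphism X Y p"
  obtains W where "\<And>e. e \<in> {e \<in> topspace X. p e = v} \<Longrightarrow> openin X (W e) \<and> e \<in> W e \<and> inj_on p (W e)"
    "\<And>e e'. \<lbrakk>e \<in> {e \<in> topspace X. p e = v}; e' \<in> {e \<in> topspace X. p e = v}; e \<noteq> e'\<rbrakk>
      \<Longrightarrow> disjnt (W e) (W e')"
proof -
  obtain A where A: "\<And>e. e \<in> {e \<in> topspace X. p e = v} \<Longrightarrow> openin X (A e)"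
      "\<And>e. e \<in> {e \<in> topspace X. p e = v} \<Longrightarrow> e \<in> A e"
      "\<And>e e'. \<lbrakk>e \<in> {e \<in> topspace X. p e = v}; e' \<in> {e \<in> topspace X. p e = v}; e \<noteq> e'\<rbrakk>
        \<Longrightarrow> disjnt (A e) (A e')"
    by (rule Hausdorff_space_disjoint_nbhds[OF assms(2) finite_fibre[OF assms(1,3), of v]]) auto
  have "\<forall>e\<in>topspace X. \<exists>U. openin X U \<and> e \<in> U \<and> inj_on p U"
    using local_homeomorphism_locally_inj[OF lh] by blast
  from bchoice[OF this] obtain B where
    B: "\<And>e. e \<in> topspace X \<Longrightarrow> openin X (B e) \<and> e \<in> B e \<and> inj_on p (B e)" by blast
  show thesis
  proof (rule that[of "\<lambda>e. A e \<inter> B e"])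
    show "openin X (A e \<inter> B e) \<and> e \<in> A e \<inter> B e \<and> inj_on p (A e \<inter> B e)"
      if "e \<in> {e \<in> topspace X. p e = v}" for e
      using A(1,2)[OF that] B[of e] that by (auto intro: inj_on_subset)
    show "disjnt (A e \<inter> B e) (A e' \<inter> B e')"
      if "e \<in> {e \<in> topspace X. p e = v}" "e' \<in> {e \<in> topspace X. p e = v}" "e \<noteq> e'" for e e'
      using A(3)[OF that] by (auto simp: disjnt_iff)
  qed
qed

text \<open>The map \<open>p\<close> is closed, as \<open>X\<close> is compact and \<open>Y\<close>
  is Hausdorff. So the image of the complement of the sheets is closed, and it misses
  \<open>v\<close> because the whole fibre lies in the sheets. Openness of \<open>p\<close> gives
  the last claim. For injective sheets that are disjoint, each fibre over \<open>U\<close> therefore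
  has exactly one point in each sheet and none elsewhere.\<close>

lemma fibre_nbhds_cover:
  assumes X: "compact_space X" and Y: "Hausdorff_space Y" and lh: "local_homeomorphism X Y p"
    and v: "v \<in> topspace Y"
    and W: "\<And>e. e \<in> {e \<in> topspace X. p e = v} \<Longrightarrow> openin X (W e) \<and> e \<in> W e"
  obtains U where "openin Y U" "v \<in> U"
    "{x \<in> topspace X. p x \<in> U} \<subseteq> (\<Union>e\<in>{e \<in> topspace X. p e = v}. W e)"
    "\<And>e. e \<in> {e \<in> topspace X. p e = v} \<Longrightarrow> U \<subseteq> p ` W e"
proof -
  let ?S = "{e \<in> topspace X. p e = v}"
  let ?C = "topspace X - (\<Union>e\<in>?S. W e)"
  note fin = finite_fibre[OF X lh, of v]
  have "closedin X ?C"
    using W by blast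
  then have "closedin Y (p ` ?C)"
    using continuous_imp_closed_map[OF local_homeomorphism_continuous[OF lh] X Y]
    by (auto simp: closed_map_def)
  then have 1: "openin Y (topspace Y - p ` ?C)" by blast
  have 2: "openin Y (topspace Y \<inter> (\<Inter>e\<in>?S. p ` W e))"
  \<comment> \<open>The fibre may be empty; the first set alone is then a neighbourhood of
    \<open>v\<close> over which there are no points at all.\<close>
  proof (cases "?S = {}")
    case True
    show ?thesis unfolding True by simp
  next
    case False
    have "openin Y (\<Inter>e\<in>?S. p ` W e)"
      by (rule openin_INT2)
        (use fin False W local_homeomorphism_open_map[OF lh] in \<open>auto simp: open_map_def\<close>)
    then show ?thesis by blast
  qed
  show thesis
  proof (rule that[OF openin_Int[OF 1 2]])
    show "v \<in> (topspace Y - p ` ?C) \<inter> (topspace Y \<inter> (\<Inter>e\<in>?S. p ` W e))"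
      using v W by force
  qed auto
qed

text \<open>This is continuity of the local inverse of an open map on an open set where the map is
  injective: the preimage of \<open>T\<close> is the image of \<open>W \<inter> T\<close>, cut down
  to \<open>U\<close>.\<close>

lemma openin_section_preimage:
  assumes "open_map X Y p" "openin X W" "inj_on p W" "openin X T" "U \<subseteq> p ` W"
  shows "openin (subtopology Y U) {u \<in> U. the_inv_into W p u \<in> T}"
proof -
  have "{u \<in> U. the_inv_into W p u \<in> T} = p ` (W \<inter> T) \<inter> U"
  proof (intro set_eqI iffI)
    fix u assume "u \<in> {u \<in> U. the_inv_into W p u \<in> T}"
    then show "u \<in> p ` (W \<inter> T) \<inter> U"
      using assms(3,5) f_the_inv_into_f[of p W u] the_inv_into_into[of p W u W] by force
  next
    fix u assume "u \<in> p ` (W \<inter> T) \<inter> U"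
    then show "u \<in> {u \<in> U. the_inv_into W p u \<in> T}"
      using assms(3) by (auto simp: the_inv_into_f_f)
  qed
  then show ?thesis
    using assms by (auto simp: openin_subtopology open_map_def)
qed

text \<open>Needed to know that inner products lie in the coefficient algebra. The sections
  \<open>sec e\<close> of the sheets enumerate the fibre over each nearby \<open>u\<close>, which
  turns the sum over a moving fibre into one over the fixed fibre of \<open>v\<close>.\<close>

lemma continuous_map_fibre_sum:
  fixes g :: "'a \<Rightarrow> complex"
  assumes X: "compact_space X" "Hausdorff_space X" and Y: "Hausdorff_space Y"
    and lh: "local_homeomorphism X Y p" and g: "continuous_map X euclidean g"
  shows "continuous_map Y euclidean (\<lambda>v. \<Sum>e\<in>{e \<in> topspace X. p e = v}. g e)"
proof -
  let ?h = "\<lambda>v. \<Sum>e\<in>{e \<in> topspace X. p e = v}. g e"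
  have "\<exists>U. openin Y U \<and> v \<in> U \<and> continuous_map (subtopology Y U) euclidean ?h"
    if v: "v \<in> topspace Y" for v
  proof -
    let ?S = "{e \<in> topspace X. p e = v}"
    obtain W where W: "\<And>e. e \<in> ?S \<Longrightarrow> openin X (W e) \<and> e \<in> W e \<and> inj_on p (W e)"
        "\<And>e e'. \<lbrakk>e \<in> ?S; e' \<in> ?S; e \<noteq> e'\<rbrakk> \<Longrightarrow> disjnt (W e) (W e')"
      by (rule local_homeomorphism_sheets[OF X lh, of v]) blast
    obtain U where U: "openin Y U" "v \<in> U" "{x \<in> topspace X. p x \<in> U} \<subseteq> (\<Union>e\<in>?S. W e)"
        "\<And>e. e \<in> ?S \<Longrightarrow> U \<subseteq> p ` W e"
      by (rule fibre_nbhds_cover[OF X(1) Y lh v, of W]) (use W in auto)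
    define sec where "sec e = the_inv_into (W e) p" for e
    have sec: "sec e u \<in> W e" "p (sec e u) = u" if "e \<in> ?S" "u \<in> U" for e u
    proof -
      have "inj_on p (W e)" "u \<in> p ` W e" using W(1)[OF that(1)] U(4)[OF that(1)] that(2) by auto
      then show "sec e u \<in> W e" "p (sec e u) = u"
        unfolding sec_def by (auto simp: f_the_inv_into_f intro: the_inv_into_into)
    qed
    have WX: "W e \<subseteq> topspace X" if "e \<in> ?S" for e
      using W(1)[OF that] openin_subset by blast
    have bij: "bij_betw (\<lambda>e. sec e u) ?S {e \<in> topspace X. p e = u}" if u: "u \<in> U" for u
      unfolding bij_betw_def
    proof
      show "inj_on (\<lambda>e. sec e u) ?S"
      proof (rule inj_onI, rule ccontr)
        fix e e' assume e: "e \<in> ?S" "e' \<in> ?S" "sec e u = sec e' u" "e \<noteq> e'"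
        then show False
          using W(2)[OF e(1,2,4)] sec(1)[OF e(1) u] sec(1)[OF e(2) u] by (auto simp: disjnt_iff)
      qed
      show "(\<lambda>e. sec e u) ` ?S = {e \<in> topspace X. p e = u}"
      proof (intro equalityI subsetI)
        fix x assume "x \<in> (\<lambda>e. sec e u) ` ?S"
        then obtain e where e: "e \<in> ?S" "x = sec e u" by blast
        then show "x \<in> {e \<in> topspace X. p e = u}"
          using sec[OF e(1) u] WX[OF e(1)] by auto
      next
        fix x assume x: "x \<in> {e \<in> topspace X. p e = u}"
        then obtain e where e: "e \<in> ?S" "x \<in> W e" using U(3) u by blast
        then have "x = sec e u"
          using x sec[OF e(1) u] W(1)[OF e(1)] by (auto dest: inj_onD)
        then show "x \<in> (\<lambda>e. sec e u) ` ?S" using e(1) by blast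
      qed
    qed
    have "continuous_map (subtopology Y U) X (sec e)" if e: "e \<in> ?S" for e
      unfolding continuous_map_def
    proof (intro conjI allI impI)
      show "sec e \<in> topspace (subtopology Y U) \<rightarrow> topspace X"
        using sec[OF e] WX[OF e] by auto
      fix T assume "openin X T"
      then show "openin (subtopology Y U) {u \<in> topspace (subtopology Y U). sec e u \<in> T}"
        using openin_section_preimage[OF local_homeomorphism_open_map[OF lh], of "W e" T U]
          W(1)[OF e] U(4)[OF e] openin_subset[OF U(1)]
        by (simp add: sec_def Int_absorb1)
    qed
    then have "continuous_map (subtopology Y U) euclidean (\<lambda>u. \<Sum>e\<in>?S. g (sec e u))"
      by (intro continuous_map_sum finite_fibre[OF X(1) lh])
        (auto intro: continuous_map_compose[OF _ g, unfolded o_def])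
    then have "continuous_map (subtopology Y U) euclidean ?h"
    proof (rule continuous_map_eq)
      fix u assume "u \<in> topspace (subtopology Y U)"
      then show "(\<Sum>e\<in>?S. g (sec e u)) = ?h u"
        using sum.reindex_bij_betw[OF bij, of u g] by simp
    qed
    then show ?thesis using U(1,2) by blast
  qed
  then have "\<forall>v\<in>topspace Y. \<exists>U. openin Y U \<and> v \<in> U \<and> continuous_map (subtopology Y U) euclidean ?h"
    by blast
  from bchoice[OF this] obtain U where U: "\<And>v. v \<in> topspace Y \<Longrightarrow>
      openin Y (U v) \<and> v \<in> U v \<and> continuous_map (subtopology Y (U v)) euclidean ?h"
    by blast
  show ?thesis
    by (rule pasting_lemma[where I = "topspace Y" and T = U and f = "\<lambda>_. ?h"]) (use U in auto)
qed

section \<open>Maps glued from sheets\<close>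

text \<open>Continuity holds because on the \<open>i\<close>-th sheet \<open>g\<close> is \<open>\<phi> \<circ> p\<close> followed by the local inverse
  of \<open>q\<close> on \<open>W' i\<close>.\<close>

lemma continuous_map_over_sheets:
  assumes p: "continuous_map X B p" and q: "open_map Y C q" and \<phi>: "continuous_map B C \<phi>"
    and W: "\<And>i. i \<in> I \<Longrightarrow> openin X (W i)"
    and disj: "\<And>i j. \<lbrakk>i \<in> I; j \<in> I; i \<noteq> j\<rbrakk> \<Longrightarrow> disjnt (W i) (W j)"
    and W': "\<And>i. i \<in> I \<Longrightarrow> openin Y (W' i) \<and> inj_on q (W' i)"
    and A: "A \<subseteq> topspace X" and D: "D \<subseteq> topspace Y"
    and g: "\<And>x. x \<in> A \<Longrightarrow> g x \<in> D \<and> q (g x) = \<phi> (p x) \<and> (\<exists>i\<in>I. x \<in> W i \<and> g x \<in> W' i)"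
  shows "continuous_map (subtopology X A) (subtopology Y D) g"
  unfolding continuous_map_in_subtopology
proof
  show "g \<in> topspace (subtopology X A) \<rightarrow> D"
    using A g by auto
  show "continuous_map (subtopology X A) Y g"
    unfolding continuous_map_def
  proof (intro conjI allI impI)
    show "g \<in> topspace (subtopology X A) \<rightarrow> topspace Y"
      using g D by auto
    fix T assume T: "openin Y T"
    show "openin (subtopology X A) {x \<in> topspace (subtopology X A). g x \<in> T}"
    proof (subst openin_subopen, intro ballI)
      fix x assume "x \<in> {x \<in> topspace (subtopology X A). g x \<in> T}"
      then have x: "x \<in> A" "g x \<in> T" by auto
      then obtain i where i: "i \<in> I" "x \<in> W i" "g x \<in> W' i" using g by blast
      \<comment> \<open>On \<open>N \<inter> A\<close> disjointness keeps the sheet index equal to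
        \<open>i\<close>. So \<open>g z\<close> is the only point of \<open>W' i\<close> above
        \<open>\<phi> (p z)\<close>, and that point lies in \<open>T\<close>.\<close>
      define N where "N = W i \<inter> {x \<in> topspace X. (\<phi> \<circ> p) x \<in> q ` (W' i \<inter> T)}"
      have "openin C (q ` (W' i \<inter> T))"
        using q W'[OF i(1)] T by (auto simp: open_map_def)
      then have "openin X N"
        unfolding N_def using W[OF i(1)]
        by (intro openin_Int openin_continuous_map_preimage[OF continuous_map_compose[OF p \<phi>]])
      then have "openin (subtopology X A) (N \<inter> A)"
        by (auto simp: openin_subtopology)
      moreover have "\<phi> (p x) \<in> q ` (W' i \<inter> T)"
        using x i g[OF x(1)] by (metis IntI imageI)
      then have "x \<in> N \<inter> A"
        using x i A by (auto simp: N_def)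
      moreover have "N \<inter> A \<subseteq> {x \<in> topspace (subtopology X A). g x \<in> T}"
      proof
        fix z assume "z \<in> N \<inter> A"
        then obtain y where z: "z \<in> A" "z \<in> W i" "y \<in> W' i" "y \<in> T" "\<phi> (p z) = q y"
          by (auto simp: N_def)
        from g[OF z(1)] obtain j where j: "j \<in> I" "z \<in> W j" "g z \<in> W' j" "q (g z) = q y"
          using z(5) by auto
        have "j = i"
          using disj[OF j(1) i(1)] z(2) j(2) by (auto simp: disjnt_iff)
        then have "g z = y"
          using j z W'[OF i(1)] by (auto dest: inj_onD)
        then show "z \<in> {x \<in> topspace (subtopology X A). g x \<in> T}"
          using z A by auto
      qed
      ultimately show "\<exists>S. openin (subtopology X A) S \<and> x \<in> S \<and>
          S \<subseteq> {x \<in> topspace (subtopology X A). g x \<in> T}" by blast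
    qed
  qed
qed

text \<open>The common index set pairs the sheets of the two sides, and \<open>g\<close> sends a
  point to the point above its \<phi>-image in the partner sheet. The inverse is built in the same
  way from \<psi>; disjointness on both sides makes a round trip return to the sheet it started
  from, where the projection is injective. The second conclusion records the sheet so that
  properties of the pairs (\<open>W i\<close>, \<open>W' i\<close>) can be transferred to
  \<open>g\<close>.\<close>

lemma homeomorphic_map_over_sheets:
  assumes p: "continuous_map X B p" "open_map X B p" and q: "continuous_map Y C q" "open_map Y C q"
    and \<phi>: "homeomorphic_map B C \<phi>"
    and W: "\<And>i. i \<in> I \<Longrightarrow> openin X (W i) \<and> inj_on p (W i)"
    and disj: "\<And>i j. \<lbrakk>i \<in> I; j \<in> I; i \<noteq> j\<rbrakk> \<Longrightarrow> disjnt (W i) (W j)"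
    and W': "\<And>i. i \<in> I \<Longrightarrow> openin Y (W' i) \<and> inj_on q (W' i)"
    and disj': "\<And>i j. \<lbrakk>i \<in> I; j \<in> I; i \<noteq> j\<rbrakk> \<Longrightarrow> disjnt (W' i) (W' j)"
    and U: "U \<subseteq> topspace B"
    and cover: "{x \<in> topspace X. p x \<in> U} \<subseteq> (\<Union>i\<in>I. W i)" "\<And>i. i \<in> I \<Longrightarrow> U \<subseteq> p ` W i"
    and cover': "{y \<in> topspace Y. q y \<in> \<phi> ` U} \<subseteq> (\<Union>i\<in>I. W' i)" "\<And>i. i \<in> I \<Longrightarrow> \<phi> ` U \<subseteq> q ` W' i"
  obtains g where
    "homeomorphic_map (subtopology X {x \<in> topspace X. p x \<in> U})
       (subtopology Y {y \<in> topspace Y. q y \<in> \<phi> ` U}) g"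
    "\<And>x. \<lbrakk>x \<in> topspace X; p x \<in> U\<rbrakk> \<Longrightarrow>
       g x \<in> topspace Y \<and> q (g x) = \<phi> (p x) \<and> (\<exists>i\<in>I. x \<in> W i \<and> g x \<in> W' i)"
proof -
  let ?A = "{x \<in> topspace X. p x \<in> U}" and ?D = "{y \<in> topspace Y. q y \<in> \<phi> ` U}"
  obtain \<psi> where \<psi>: "homeomorphic_maps B C \<phi> \<psi>"
    using \<phi> homeomorphic_map_maps by blast
  then have \<phi>c: "continuous_map B C \<phi>" and \<psi>c: "continuous_map C B \<psi>"
    and \<psi>\<phi>: "\<And>b. b \<in> topspace B \<Longrightarrow> \<psi> (\<phi> b) = b"
    by (auto simp: homeomorphic_maps_def)
  have "\<exists>y\<in>?D. q y = \<phi> (p x) \<and> (\<exists>i\<in>I. x \<in> W i \<and> y \<in> W' i)" if x: "x \<in> ?A" for x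
  proof -
    obtain i where i: "i \<in> I" "x \<in> W i" using cover(1) x by blast
    then obtain y where y: "y \<in> W' i" "q y = \<phi> (p x)" using cover'(2)[OF i(1)] x by force
    then have "y \<in> ?D" using W'[OF i(1)] openin_subset x by fastforce
    then show ?thesis using i y by blast
  qed
  then have "\<forall>x\<in>?A. \<exists>y. y \<in> ?D \<and> q y = \<phi> (p x) \<and> (\<exists>i\<in>I. x \<in> W i \<and> y \<in> W' i)" by blast
  from bchoice[OF this] obtain g where g: "\<And>x. x \<in> ?A \<Longrightarrow>
      g x \<in> ?D \<and> q (g x) = \<phi> (p x) \<and> (\<exists>i\<in>I. x \<in> W i \<and> g x \<in> W' i)" by blast
  have "\<exists>x\<in>?A. p x = \<psi> (q y) \<and> (\<exists>i\<in>I. y \<in> W' i \<and> x \<in> W i)" if y: "y \<in> ?D" for y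
  proof -
    obtain i where i: "i \<in> I" "y \<in> W' i" using cover'(1) y by blast
    obtain u where u: "u \<in> U" "q y = \<phi> u" using y by auto
    then have uq: "\<psi> (q y) = u" using \<psi>\<phi> U by auto
    obtain x where x: "x \<in> W i" "p x = u" using cover(2)[OF i(1)] u by force
    then have "x \<in> ?A" using W[OF i(1)] openin_subset u by fastforce
    then show ?thesis using i x uq by (intro bexI[of _ x]) auto
  qed
  then have "\<forall>y\<in>?D. \<exists>x. x \<in> ?A \<and> p x = \<psi> (q y) \<and> (\<exists>i\<in>I. y \<in> W' i \<and> x \<in> W i)" by blast
  from bchoice[OF this] obtain h where h: "\<And>y. y \<in> ?D \<Longrightarrow>
      h y \<in> ?A \<and> p (h y) = \<psi> (q y) \<and> (\<exists>i\<in>I. y \<in> W' i \<and> h y \<in> W i)" by blast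
  have gc: "continuous_map (subtopology X ?A) (subtopology Y ?D) g"
    by (rule continuous_map_over_sheets[OF p(1) q(2) \<phi>c _ disj W' _ _ g]) (use W in auto)
  have hc: "continuous_map (subtopology Y ?D) (subtopology X ?A) h"
    by (rule continuous_map_over_sheets[OF q(1) p(2) \<psi>c _ disj' W _ _ h]) (use W' in auto)
  have hg: "h (g x) = x" if x: "x \<in> ?A" for x
  proof -
    obtain i where i: "i \<in> I" "x \<in> W i" "g x \<in> W' i" using g[OF x] by blast
    have gx: "g x \<in> ?D" using g[OF x] by blast
    obtain j where j: "j \<in> I" "g x \<in> W' j" "h (g x) \<in> W j" using h[OF gx] by blast
    have "j = i" using disj'[OF j(1) i(1)] i j by (auto simp: disjnt_iff)
    moreover have "p (h (g x)) = p x"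
      using h[OF gx] g[OF x] \<psi>\<phi> U x by auto
    ultimately show ?thesis
      using i j W[OF i(1)] by (auto dest: inj_onD)
  qed
  have gh: "g (h y) = y" if y: "y \<in> ?D" for y
  proof -
    obtain i where i: "i \<in> I" "y \<in> W' i" "h y \<in> W i" using h[OF y] by blast
    have hy: "h y \<in> ?A" using h[OF y] by blast
    obtain j where j: "j \<in> I" "h y \<in> W j" "g (h y) \<in> W' j" using g[OF hy] by blast
    have "j = i" using disj[OF j(1) i(1)] i j by (auto simp: disjnt_iff)
    obtain u where u: "u \<in> U" "q y = \<phi> u" using y by auto
    then have "\<phi> (\<psi> (q y)) = q y" using \<psi>\<phi> U by auto
    then have "q (g (h y)) = q y"
      using h[OF y] g[OF hy] by auto
    with \<open>j = i\<close> show ?thesis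
      using i j W'[OF i(1)] by (auto dest: inj_onD)
  qed
  have "homeomorphic_maps (subtopology X ?A) (subtopology Y ?D) g h"
    unfolding homeomorphic_maps_def using gc hc hg gh by auto
  then have "homeomorphic_map (subtopology X ?A) (subtopology Y ?D) g"
    using homeomorphic_map_maps by blast
  then show thesis
    by (rule that) (use g in auto)
qed

section \<open>Isomorphisms of graph correspondences\<close>

lemma sum_cnj_mult_self_eq_0_iff:
  assumes "finite S"
  shows "(\<Sum>i\<in>S. cnj (z i) * z i) = 0 \<longleftrightarrow> (\<forall>i\<in>S. z i = 0)"
proof -
  have "(\<Sum>i\<in>S. cnj (z i) * z i) = complex_of_real (\<Sum>i\<in>S. (cmod (z i))\<^sup>2)"
    by (simp add: complex_norm_square mult.commute del: of_real_power)
  also have "\<dots> = 0 \<longleftrightarrow> (\<forall>i\<in>S. z i = 0)"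
    by (subst of_real_eq_0_iff, subst sum_nonneg_eq_0_iff[OF assms]) auto
  finally show ?thesis .
qed

lemma compact_graph_facts:
  assumes "compact_topological_graph G"
  shows "compact_space (verts G)" "Hausdorff_space (verts G)"
    "compact_space (edges G)" "Hausdorff_space (edges G)"
    "continuous_map (edges G) (verts G) (rng G)"
    "local_homeomorphism (edges G) (verts G) (src G)"
  using assms by (auto simp: compact_topological_graph_def topological_graph_def)

lemma linear_combination_in:
  assumes "finite J" "\<And>j. j \<in> J \<Longrightarrow> x j \<in> cont_funs X"
  shows "(\<lambda>e\<in>topspace X. \<Sum>j\<in>J. c j * x j e) \<in> cont_funs X"
  using assms by (intro restrict_in_cont_funs continuous_intros cont_funs_continuous) auto

text \<open>Each \<open>x e\<close> is 1 at \<open>e\<close> and, by disjointness of the sheets, 0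
  at the other edges of the fibre. Hence the bumps restrict to the standard basis of functions on
  the fibre; the last conclusion says this in the form in which linear combinations are
  evaluated.\<close>

lemma fibre_bumps:
  assumes G: "compact_topological_graph G"
    and W: "\<And>e. e \<in> {e \<in> topspace (edges G). src G e = v} \<Longrightarrow> openin (edges G) (W e) \<and> e \<in> W e"
    and disj: "\<And>e e'. \<lbrakk>e \<in> {e \<in> topspace (edges G). src G e = v};
      e' \<in> {e \<in> topspace (edges G). src G e = v}; e \<noteq> e'\<rbrakk> \<Longrightarrow> disjnt (W e) (W e')"
  obtains x where
    "\<And>e. e \<in> {e \<in> topspace (edges G). src G e = v} \<Longrightarrow> x e \<in> cont_funs (edges G)"
    "\<And>e p. \<lbrakk>e \<in> {e \<in> topspace (edges G). src G e = v}; p \<in> topspace (edges G) - W e\<rbrakk> \<Longrightarrow> x e p = 0"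
    "\<And>c e. e \<in> {e \<in> topspace (edges G). src G e = v} \<Longrightarrow>
      (\<Sum>e'\<in>{e \<in> topspace (edges G). src G e = v}. c e' * x e' e) = c e"
proof -
  let ?S = "{e \<in> topspace (edges G). src G e = v}"
  note GG = compact_graph_facts[OF G]
  have "\<forall>e\<in>?S. \<exists>x. x \<in> cont_funs (edges G) \<and> x e = 1 \<and>
      (\<forall>p\<in>topspace (edges G) - W e. x p = 0)"
  proof
    fix e assume "e \<in> ?S"
    then obtain x where "x \<in> cont_funs (edges G)" "x e = 1"
        "\<And>p. p \<in> topspace (edges G) - W e \<Longrightarrow> x p = 0"
      using W urysohn_bump[OF GG(3,4), of "W e" e] by blast
    then show "\<exists>x. x \<in> cont_funs (edges G) \<and> x e = 1 \<and>
        (\<forall>p\<in>topspace (edges G) - W e. x p = 0)" by (intro exI[of _ x]) auto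
  qed
  from bchoice[OF this] obtain x where x: "\<And>e. e \<in> ?S \<Longrightarrow> x e \<in> cont_funs (edges G) \<and>
      x e e = 1 \<and> (\<forall>p\<in>topspace (edges G) - W e. x e p = 0)" by blast
  show thesis
  proof (rule that[of x])
    fix c e assume e: "e \<in> ?S"
    have "x e' e = (if e' = e then 1 else 0)" if e': "e' \<in> ?S" for e'
    proof (cases "e' = e")
      case False
      then have "e \<notin> W e'" using disj[OF e' e] W[OF e] by (auto simp: disjnt_iff)
      then show ?thesis using x[OF e'] e False by auto
    qed (use x e in auto)
    then have "(\<Sum>e'\<in>?S. c e' * x e' e) = (\<Sum>e'\<in>?S. if e' = e then c e else 0)"
      by (intro sum.cong) auto
    also have "\<dots> = c e"
      using finite_fibre[OF GG(3,6), of v] e by (subst sum.delta) auto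
    finally show "(\<Sum>e'\<in>?S. c e' * x e' e) = c e" .
  qed (use x in auto)
qed

section \<open>The matrix of the module isomorphism between corresponding fibres\<close>

context
  fixes E :: "('v, 'e) top_graph" and F :: "('w, 'f) top_graph"
    and \<phi> :: "'v \<Rightarrow> 'w" and \<theta> :: "('e \<Rightarrow> complex) \<Rightarrow> 'f \<Rightarrow> complex"
  assumes E: "compact_topological_graph E" and F: "compact_topological_graph F"
    and \<phi>: "homeomorphic_map (verts E) (verts F) \<phi>"
    and \<theta>_bij: "bij_betw \<theta> (cont_funs (edges E)) (cont_funs (edges F))"
    and \<theta>_add: "\<And>x y f. \<lbrakk>x \<in> cont_funs (edges E); y \<in> cont_funs (edges E); f \<in> topspace (edges F)\<rbrakk>
      \<Longrightarrow> \<theta> (\<lambda>e\<in>topspace (edges E). x e + y e) f = \<theta> x f + \<theta> y f"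
    and \<theta>_scale: "\<And>c x f. \<lbrakk>x \<in> cont_funs (edges E); f \<in> topspace (edges F)\<rbrakk>
      \<Longrightarrow> \<theta> (\<lambda>e\<in>topspace (edges E). c * x e) f = c * \<theta> x f"
    and \<theta>_left: "\<And>a x f v. \<lbrakk>a \<in> cont_funs (verts E); x \<in> cont_funs (edges E);
        f \<in> topspace (edges F); v \<in> topspace (verts E); rng F f = \<phi> v\<rbrakk>
      \<Longrightarrow> \<theta> (\<lambda>e\<in>topspace (edges E). a (rng E e) * x e) f = a v * \<theta> x f"
    and \<theta>_inner: "\<And>x v. \<lbrakk>x \<in> cont_funs (edges E); v \<in> topspace (verts E)\<rbrakk> \<Longrightarrow>
        (\<Sum>f\<in>{f \<in> topspace (edges F). src F f = \<phi> v}. cnj (\<theta> x f) * \<theta> x f) =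
        (\<Sum>e\<in>{e \<in> topspace (edges E). src E e = v}. cnj (x e) * x e)"
begin

lemmas EG = compact_graph_facts[OF E] and FG = compact_graph_facts[OF F]

lemma \<theta>_in: "x \<in> cont_funs (edges E) \<Longrightarrow> \<theta> x \<in> cont_funs (edges F)"
  using \<theta>_bij by (auto simp: bij_betw_def)

text \<open>The inner product of an element with itself is a sum of squares over the fibre. From
  right to left this makes \<theta> well defined as a map between fibres, from left to right it
  makes that map injective.\<close>

lemma vanishes_on_fibre_iff:
  assumes "x \<in> cont_funs (edges E)" "v \<in> topspace (verts E)"
  shows "(\<forall>f\<in>{f \<in> topspace (edges F). src F f = \<phi> v}. \<theta> x f = 0) \<longleftrightarrow>
    (\<forall>e\<in>{e \<in> topspace (edges E). src E e = v}. x e = 0)"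
  by (simp only: \<theta>_inner[OF assms]
      sum_cnj_mult_self_eq_0_iff[OF finite_fibre[OF FG(3,6)], symmetric]
      sum_cnj_mult_self_eq_0_iff[OF finite_fibre[OF EG(3,6)], symmetric])

lemma \<theta>_linear_combination:
  assumes "finite J" "\<And>j. j \<in> J \<Longrightarrow> x j \<in> cont_funs (edges E)" "f \<in> topspace (edges F)"
  shows "\<theta> (\<lambda>e\<in>topspace (edges E). \<Sum>j\<in>J. c j * x j e) f = (\<Sum>j\<in>J. c j * \<theta> (x j) f)"
  using assms(1,2)
proof (induction J)
  case empty
  have "(\<lambda>e\<in>topspace (edges E). 0) \<in> cont_funs (edges E)"
    by (intro restrict_in_cont_funs) simp
  from \<theta>_scale[OF this assms(3), of 0]
  have "\<theta> (\<lambda>e\<in>topspace (edges E). 0 * (\<lambda>e\<in>topspace (edges E). 0) e) f = 0"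
    by (simp only: mult_zero_left)
  moreover have "(\<lambda>e\<in>topspace (edges E). 0 * (\<lambda>e\<in>topspace (edges E). 0) e) =
      (\<lambda>e\<in>topspace (edges E). \<Sum>j\<in>{}. c j * x j e)"
    by (auto simp: fun_eq_iff)
  ultimately show ?case by (simp only: sum.empty)
next
  case (insert j J)
  let ?s = "\<lambda>e\<in>topspace (edges E). \<Sum>j\<in>J. c j * x j e"
  let ?t = "\<lambda>e\<in>topspace (edges E). c j * x j e"
  have xj: "x j \<in> cont_funs (edges E)" using insert by simp
  have s: "?s \<in> cont_funs (edges E)"
    by (intro linear_combination_in) (use insert in auto)
  have t: "?t \<in> cont_funs (edges E)"
    using xj by (intro restrict_in_cont_funs continuous_intros cont_funs_continuous) auto
  have "(\<lambda>e\<in>topspace (edges E). \<Sum>j\<in>insert j J. c j * x j e) =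
      (\<lambda>e\<in>topspace (edges E). ?t e + ?s e)"
    using insert.hyps by (auto simp: fun_eq_iff)
  then have "\<theta> (\<lambda>e\<in>topspace (edges E). \<Sum>j\<in>insert j J. c j * x j e) f = \<theta> ?t f + \<theta> ?s f"
    using \<theta>_add[OF t s assms(3)] by simp
  also have "\<dots> = c j * \<theta> (x j) f + (\<Sum>j\<in>J. c j * \<theta> (x j) f)"
    by (simp only: \<theta>_scale[OF xj assms(3)] insert.IH[OF insert.prems[OF insertI2]])
  finally show ?case by (simp only: sum.insert[OF insert.hyps])
qed

text \<open>On its fibre \<open>x\<close> lives on \<open>e\<close> alone. If the ranges did not
  correspond, some \<open>a\<close> would vanish at the range of \<open>e\<close> and be 1 at the
  vertex \<open>v\<close> corresponding to the range of \<open>f\<close>. Then \<open>a\<close>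
  acting on \<open>x\<close> vanishes on the fibre, hence so does its image under \<theta>, whose
  value at \<open>f\<close> is nevertheless \<open>\<theta> x f\<close>.\<close>

lemma range_preserved:
  assumes x: "x \<in> cont_funs (edges E)"
    and e: "e \<in> topspace (edges E)" and f: "f \<in> topspace (edges F)"
    and src: "src F f = \<phi> (src E e)" and nz: "\<theta> x f \<noteq> 0"
    and supp: "\<And>e'. \<lbrakk>e' \<in> topspace (edges E); src E e' = src E e; e' \<noteq> e\<rbrakk> \<Longrightarrow> x e' = 0"
  shows "rng F f = \<phi> (rng E e)"
proof (rule ccontr)
  assume ne: "rng F f \<noteq> \<phi> (rng E e)"
  have re: "rng E e \<in> topspace (verts E)" and rf: "rng F f \<in> topspace (verts F)"
    using e f EG(5) FG(5) by (auto simp: continuous_map_def)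
  have se: "src E e \<in> topspace (verts E)"
    using e local_homeomorphism_continuous[OF EG(6)] by (auto simp: continuous_map_def)
  obtain v where v: "v \<in> topspace (verts E)" "rng F f = \<phi> v"
    using rf homeomorphic_imp_surjective_map[OF \<phi>] by blast
  have "openin (verts E) (topspace (verts E) - {rng E e})"
    using re EG(2) by (simp add: closedin_Hausdorff_singleton openin_diff)
  from urysohn_bump[OF EG(1,2) this, of v]
  obtain a where a: "a \<in> cont_funs (verts E)" "a v = 1" "a (rng E e) = 0"
    using v ne re by (metis DiffD2 DiffI insertI1 singletonD)
  let ?ax = "\<lambda>e\<in>topspace (edges E). a (rng E e) * x e"
  have "continuous_map (edges E) euclidean (\<lambda>e. a (rng E e))"
    using continuous_map_compose[OF EG(5) cont_funs_continuous[OF a(1)]] by (simp add: o_def)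
  then have ax: "?ax \<in> cont_funs (edges E)"
    by (intro restrict_in_cont_funs continuous_map_complex_mult cont_funs_continuous[OF x])
  have "?ax e' = 0" if "e' \<in> topspace (edges E)" "src E e' = src E e" for e'
    using supp[OF that] a(3) that by (cases "e' = e") simp_all
  then have "\<forall>f\<in>{f \<in> topspace (edges F). src F f = \<phi> (src E e)}. \<theta> ?ax f = 0"
    unfolding vanishes_on_fibre_iff[OF ax se] by blast
  then have "\<theta> ?ax f = 0" using f src by blast
  moreover have "\<theta> ?ax f = \<theta> x f"
    unfolding \<theta>_left[OF a(1) x f v] a(2) by (rule mult_1_left)
  ultimately show False using nz by (simp only:)
qed

text \<open>On a pair of corresponding fibres \<open>\<theta>\<close> is an invertible matrix, so both its columns and its
  rows are independent. The first gives an injection between the fibres along nonzero entries,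
  the second that the fibres have the same size.\<close>

lemma fibre_transversal:
  assumes v: "v \<in> topspace (verts E)"
    and x: "\<And>e. e \<in> {e \<in> topspace (edges E). src E e = v} \<Longrightarrow> x e \<in> cont_funs (edges E)"
    and xsum: "\<And>c e. e \<in> {e \<in> topspace (edges E). src E e = v} \<Longrightarrow>
      (\<Sum>e'\<in>{e \<in> topspace (edges E). src E e = v}. c e' * x e' e) = c e"
  obtains \<sigma> where
    "bij_betw \<sigma> {e \<in> topspace (edges E). src E e = v} {f \<in> topspace (edges F). src F f = \<phi> v}"
    "\<And>e. e \<in> {e \<in> topspace (edges E). src E e = v} \<Longrightarrow> \<theta> (x e) (\<sigma> e) \<noteq> 0"
proof -
  let ?S = "{e \<in> topspace (edges E). src E e = v}"
  let ?S' = "{f \<in> topspace (edges F). src F f = \<phi> v}"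
  note finS = finite_fibre[OF EG(3,6), of v] and finS' = finite_fibre[OF FG(3,6), of "\<phi> v"]
  have comb: "(\<lambda>e\<in>topspace (edges E). \<Sum>e'\<in>?S. c e' * x e' e) \<in> cont_funs (edges E)" for c
    by (rule linear_combination_in[OF finS x])
  have \<theta>_comb: "\<theta> (\<lambda>e\<in>topspace (edges E). \<Sum>e'\<in>?S. c e' * x e' e) f = (\<Sum>e'\<in>?S. c e' * \<theta> (x e') f)"
    if "f \<in> ?S'" for c f
    by (rule \<theta>_linear_combination[OF finS x]) (use that in auto)
  have cols: "\<forall>e\<in>?S. c e = 0" if c: "\<forall>f\<in>?S'. (\<Sum>e\<in>?S. c e * \<theta> (x e) f) = 0" for c
  proof -
    have "\<forall>f\<in>?S'. \<theta> (\<lambda>e\<in>topspace (edges E). \<Sum>e'\<in>?S. c e' * x e' e) f = 0"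
      using \<theta>_comb c by simp
    then have "\<forall>e\<in>?S. (\<lambda>e\<in>topspace (edges E). \<Sum>e'\<in>?S. c e' * x e' e) e = 0"
      using vanishes_on_fibre_iff[OF comb v] by blast
    then show ?thesis using xsum[of _ c] by auto
  qed
  have rows: "\<forall>f\<in>?S'. d f = 0" if d: "\<forall>e\<in>?S. (\<Sum>f\<in>?S'. d f * \<theta> (x e) f) = 0" for d
  proof -
    obtain W' where W': "\<And>f. f \<in> ?S' \<Longrightarrow> openin (edges F) (W' f) \<and> f \<in> W' f \<and> inj_on (src F) (W' f)"
        "\<And>f f'. \<lbrakk>f \<in> ?S'; f' \<in> ?S'; f \<noteq> f'\<rbrakk> \<Longrightarrow> disjnt (W' f) (W' f')"
      by (rule local_homeomorphism_sheets[OF FG(3,4,6), of "\<phi> v"]) blast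
    obtain y where y: "\<And>f. f \<in> ?S' \<Longrightarrow> y f \<in> cont_funs (edges F)"
        "\<And>c f. f \<in> ?S' \<Longrightarrow> (\<Sum>f'\<in>?S'. c f' * y f' f) = c f"
      by (rule fibre_bumps[OF F, of "\<phi> v" W']) (use W' in auto)
    \<comment> \<open>The conjugates of \<open>d\<close> are prescribed on the fibre over
      \<open>\<phi> v\<close>, and surjectivity of \<theta> provides a preimage \<open>z\<close>.
      Expanding \<open>\<theta> z\<close> in the columns turns the sum of the squares of
      \<open>d\<close> into a combination of the sums that vanish by assumption.\<close>
    let ?u = "\<lambda>f\<in>topspace (edges F). \<Sum>f'\<in>?S'. cnj (d f') * y f' f"
    have "?u \<in> cont_funs (edges F)"
      by (rule linear_combination_in[OF finS' y(1)])
    then have "?u \<in> \<theta> ` cont_funs (edges E)"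
      unfolding bij_betw_imp_surj_on[OF \<theta>_bij] .
    then obtain z where z: "?u = \<theta> z" "z \<in> cont_funs (edges E)"
      by (rule imageE)
    have u: "\<theta> z f = cnj (d f)" if "f \<in> ?S'" for f
      using y(2)[OF that, of "\<lambda>f. cnj (d f)"] fun_cong[OF z(1), of f] that by simp
    \<comment> \<open>\<open>?w\<close> is minus the interpolation of \<open>z\<close> by the bumps,
      so \<open>?zw\<close> vanishes on the fibre of \<open>v\<close>, and there \<theta> sends
      \<open>z\<close> and its interpolation to the same values.\<close>
    let ?w = "\<lambda>e\<in>topspace (edges E). \<Sum>e'\<in>?S. - z e' * x e' e"
    let ?zw = "\<lambda>e\<in>topspace (edges E). z e + ?w e"
    have w: "?w \<in> cont_funs (edges E)" by (rule comb)
    have "?zw \<in> cont_funs (edges E)"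
      by (rule restrict_in_cont_funs[OF continuous_map_add[OF
            cont_funs_continuous[OF z(2)] cont_funs_continuous[OF w]]])
    moreover have "\<forall>e\<in>?S. ?zw e = 0"
      using xsum[of _ "\<lambda>e. - z e"] by auto
    ultimately have "\<forall>f\<in>?S'. \<theta> ?zw f = 0"
      using vanishes_on_fibre_iff[of ?zw, OF _ v] by blast
    then have zsum: "\<theta> z f = (\<Sum>e\<in>?S. z e * \<theta> (x e) f)" if "f \<in> ?S'" for f
      using \<theta>_add[OF z(2) w, of f] \<theta>_comb[OF that, of "\<lambda>e. - z e"] that
      by (simp add: sum_negf)
    have "(\<Sum>f\<in>?S'. cnj (d f) * d f) = (\<Sum>f\<in>?S'. \<Sum>e\<in>?S. z e * (d f * \<theta> (x e) f))"
    proof (rule sum.cong[OF refl])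
      fix f assume f: "f \<in> ?S'"
      have "cnj (d f) * d f = d f * (\<Sum>e\<in>?S. z e * \<theta> (x e) f)"
        using u[OF f] zsum[OF f] by simp
      then show "cnj (d f) * d f = (\<Sum>e\<in>?S. z e * (d f * \<theta> (x e) f))"
        by (simp add: sum_distrib_left mult.left_commute)
    qed
    also have "\<dots> = (\<Sum>e\<in>?S. z e * (\<Sum>f\<in>?S'. d f * \<theta> (x e) f))"
      by (subst sum.swap) (simp add: sum_distrib_left)
    also have "\<dots> = 0" using d by simp
    finally show ?thesis
      using sum_cnj_mult_self_eq_0_iff[OF finS'] by blast
  qed
  obtain \<sigma> where \<sigma>: "inj_on \<sigma> ?S" "\<sigma> ` ?S \<subseteq> ?S'" "\<forall>e\<in>?S. \<theta> (x e) (\<sigma> e) \<noteq> 0"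
    using independent_columns_transversal[OF finS finS', of "\<lambda>f e. \<theta> (x e) f"] cols by blast
  obtain \<tau> where \<tau>: "inj_on \<tau> ?S'" "\<tau> ` ?S' \<subseteq> ?S"
    using independent_columns_transversal[OF finS' finS, of "\<lambda>e f. \<theta> (x e) f"] rows by blast
  have "card (\<sigma> ` ?S) = card ?S'"
    using card_inj_on_le[OF \<sigma>(1,2) finS'] card_inj_on_le[OF \<tau> finS] card_image[OF \<sigma>(1)] by simp
  then have "bij_betw \<sigma> ?S ?S'"
    using card_subset_eq[OF finS' \<sigma>(2)] \<sigma>(1) by (simp add: bij_betw_def)
  then show thesis by (rule that) (use \<sigma>(3) in auto)
qed

text \<open>Over every vertex of \<open>U\<close> the function \<open>x e\<close> is supported on
  the single edge in \<open>W e\<close>, so up to a scalar \<open>\<theta> (x e)\<close> is still a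
  column of the matrix there. Pairing \<open>W e\<close> with a sheet where
  \<open>\<theta> (x e)\<close> has no zero thus pairs edges along nonzero entries.\<close>

lemma exists_local_edge_homeomorphism:
  assumes v: "v \<in> topspace (verts E)"
  obtains U g where "openin (verts E) U" "v \<in> U"
    "homeomorphic_map (subtopology (edges E) (edges_from E U))
       (subtopology (edges F) (edges_from F (\<phi> ` U))) g"
    "\<And>e. e \<in> edges_from E U \<Longrightarrow> rng F (g e) = \<phi> (rng E e) \<and> src F (g e) = \<phi> (src E e)"
proof -
  let ?S = "{e \<in> topspace (edges E). src E e = v}"
  let ?S' = "{f \<in> topspace (edges F). src F f = \<phi> v}"
  have \<phi>v: "\<phi> v \<in> topspace (verts F)"
    using v homeomorphic_imp_surjective_map[OF \<phi>] by blast
  obtain W where W: "\<And>e. e \<in> ?S \<Longrightarrow> openin (edges E) (W e) \<and> e \<in> W e \<and> inj_on (src E) (W e)"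
      "\<And>e e'. \<lbrakk>e \<in> ?S; e' \<in> ?S; e \<noteq> e'\<rbrakk> \<Longrightarrow> disjnt (W e) (W e')"
    by (rule local_homeomorphism_sheets[OF EG(3,4,6), of v]) blast
  obtain x where x: "\<And>e. e \<in> ?S \<Longrightarrow> x e \<in> cont_funs (edges E)"
      "\<And>e p. \<lbrakk>e \<in> ?S; p \<in> topspace (edges E) - W e\<rbrakk> \<Longrightarrow> x e p = 0"
      "\<And>c e. e \<in> ?S \<Longrightarrow> (\<Sum>e'\<in>?S. c e' * x e' e) = c e"
    by (rule fibre_bumps[OF E, of v W]) (use W in auto)
  obtain \<sigma> where \<sigma>: "bij_betw \<sigma> ?S ?S'" "\<And>e. e \<in> ?S \<Longrightarrow> \<theta> (x e) (\<sigma> e) \<noteq> 0"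
    by (rule fibre_transversal[OF v x(1,3)]) auto
  have \<sigma>S: "\<sigma> e \<in> ?S'" if "e \<in> ?S" for e
    using \<sigma>(1) that by (auto simp: bij_betw_def)
  have \<sigma>inj: "inj_on \<sigma> ?S" using \<sigma>(1) by (simp add: bij_betw_def)
  obtain N where N: "\<And>f. f \<in> ?S' \<Longrightarrow> openin (edges F) (N f) \<and> f \<in> N f \<and> inj_on (src F) (N f)"
      "\<And>f f'. \<lbrakk>f \<in> ?S'; f' \<in> ?S'; f \<noteq> f'\<rbrakk> \<Longrightarrow> disjnt (N f) (N f')"
    by (rule local_homeomorphism_sheets[OF FG(3,4,6), of "\<phi> v"]) blast
  \<comment> \<open>The sheet around \<open>\<sigma> e\<close> is shrunk to where the entry stays
    nonzero, and indexed by \<open>e\<close> so that it becomes the partner of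
    \<open>W e\<close>.\<close>
  define W' where "W' e = N (\<sigma> e) \<inter> {f \<in> topspace (edges F). \<theta> (x e) f \<noteq> 0}" for e
  have W'1: "openin (edges F) (W' e) \<and> inj_on (src F) (W' e)" and W'2: "\<sigma> e \<in> W' e" if e: "e \<in> ?S" for e
    using N(1)[OF \<sigma>S[OF e]] \<sigma>(2)[OF e] \<sigma>S[OF e] openin_nonzero_set[OF cont_funs_continuous[OF \<theta>_in[OF x(1)[OF e]]]]
    by (auto simp: W'_def intro: inj_on_subset)
  have W'disj: "disjnt (W' e) (W' e')" if "e \<in> ?S" "e' \<in> ?S" "e \<noteq> e'" for e e'
    using N(2)[OF \<sigma>S[OF that(1)] \<sigma>S[OF that(2)]] inj_onD[OF \<sigma>inj _ that(1,2)] that(3)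
    by (auto simp: W'_def disjnt_iff)
  obtain U1 where U1: "openin (verts E) U1" "v \<in> U1"
      "{e \<in> topspace (edges E). src E e \<in> U1} \<subseteq> (\<Union>e\<in>?S. W e)"
      "\<And>e. e \<in> ?S \<Longrightarrow> U1 \<subseteq> src E ` W e"
    by (rule fibre_nbhds_cover[OF EG(3,2,6) v, of W]) (use W in auto)
  \<comment> \<open>The covering lemma expects sheets indexed by the fibre over
    \<open>\<phi> v\<close>, so \<open>W'\<close> is reindexed along the inverse of
    \<sigma>.\<close>
  let ?inv = "the_inv_into ?S \<sigma>"
  have inv: "?inv f \<in> ?S" "\<sigma> (?inv f) = f" if "f \<in> ?S'" for f
    using the_inv_into_into[OF \<sigma>inj, of f ?S] f_the_inv_into_f[OF \<sigma>inj, of f] \<sigma>(1) that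
    by (auto simp: bij_betw_def)
  obtain U2 where U2: "openin (verts F) U2" "\<phi> v \<in> U2"
      "{f \<in> topspace (edges F). src F f \<in> U2} \<subseteq> (\<Union>f\<in>?S'. W' (?inv f))"
      "\<And>f. f \<in> ?S' \<Longrightarrow> U2 \<subseteq> src F ` W' (?inv f)"
  proof (rule fibre_nbhds_cover[OF FG(3,2,6) \<phi>v, of "\<lambda>f. W' (?inv f)"])
    show "openin (edges F) (W' (?inv f)) \<and> f \<in> W' (?inv f)" if "f \<in> ?S'" for f
      using W'1[OF inv(1)[OF that]] W'2[OF inv(1)[OF that]] inv(2)[OF that] by simp
  qed blast
  define U where "U = U1 \<inter> {u \<in> topspace (verts E). \<phi> u \<in> U2}"
  have U: "openin (verts E) U" "v \<in> U" "U \<subseteq> U1" "\<phi> ` U \<subseteq> U2"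
    using U1(1,2) U2(2) v
      openin_continuous_map_preimage[OF homeomorphic_imp_continuous_map[OF \<phi>] U2(1)]
    by (auto simp: U_def)
  obtain g where g: "homeomorphic_map (subtopology (edges E) {e \<in> topspace (edges E). src E e \<in> U})
       (subtopology (edges F) {f \<in> topspace (edges F). src F f \<in> \<phi> ` U}) g"
    "\<And>e. \<lbrakk>e \<in> topspace (edges E); src E e \<in> U\<rbrakk> \<Longrightarrow>
       g e \<in> topspace (edges F) \<and> src F (g e) = \<phi> (src E e) \<and> (\<exists>i\<in>?S. e \<in> W i \<and> g e \<in> W' i)"
  proof (rule homeomorphic_map_over_sheets[OF
        local_homeomorphism_continuous[OF EG(6)] local_homeomorphism_open_map[OF EG(6)]
        local_homeomorphism_continuous[OF FG(6)] local_homeomorphism_open_map[OF FG(6)]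
        \<phi>, of ?S W W' U])
    show "openin (edges E) (W i) \<and> inj_on (src E) (W i)" if "i \<in> ?S" for i
      using W(1)[OF that] by simp
    show "U \<subseteq> topspace (verts E)" using U(1) openin_subset by blast
    show "{e \<in> topspace (edges E). src E e \<in> U} \<subseteq> (\<Union>i\<in>?S. W i)"
      using U1(3) U(3) by blast
    show "U \<subseteq> src E ` W i" if "i \<in> ?S" for i
      using U1(4)[OF that] U(3) by blast
    show "{f \<in> topspace (edges F). src F f \<in> \<phi> ` U} \<subseteq> (\<Union>i\<in>?S. W' i)"
      using U2(3) U(4) inv(1) by blast
    show "\<phi> ` U \<subseteq> src F ` W' i" if "i \<in> ?S" for i
      using U2(4)[OF \<sigma>S[OF that]] the_inv_into_f_f[OF \<sigma>inj that] U(4) by simp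
    show "disjnt (W i) (W j)" if "i \<in> ?S" "j \<in> ?S" "i \<noteq> j" for i j
      using that by (rule W(2))
    show "openin (edges F) (W' i) \<and> inj_on (src F) (W' i)" if "i \<in> ?S" for i
      using that by (rule W'1)
    show "disjnt (W' i) (W' j)" if "i \<in> ?S" "j \<in> ?S" "i \<noteq> j" for i j
      using that by (rule W'disj)
  qed blast
  have "rng F (g e) = \<phi> (rng E e) \<and> src F (g e) = \<phi> (src E e)" if "e \<in> edges_from E U" for e
  proof -
    have e: "e \<in> topspace (edges E)" "src E e \<in> U" using that by (auto simp: edges_from_def)
    obtain i where i: "i \<in> ?S" "e \<in> W i" "g e \<in> W' i" using g(2)[OF e] by blast
    \<comment> \<open>\<open>x i\<close> vanishes off \<open>W i\<close>, and \<open>W i\<close>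
      contains only one edge with the source of \<open>e\<close>, namely \<open>e\<close>. Together
      with \<open>\<theta> (x i) (g e) \<noteq> 0\<close>, which is part of
      \<open>g e \<in> W' i\<close>, this is what \<open>range_preserved\<close> asks for.\<close>
    have "x i e' = 0" if "e' \<in> topspace (edges E)" "src E e' = src E e" "e' \<noteq> e" for e'
      using x(2)[OF i(1), of e'] that i(2) W(1)[OF i(1)] by (auto dest: inj_onD)
    then have "rng F (g e) = \<phi> (rng E e)"
      using range_preserved[OF x(1)[OF i(1)] e(1), of "g e"] g(2)[OF e] i(3) by (auto simp: W'_def)
    then show ?thesis using g(2)[OF e] by simp
  qed
  moreover have "edges_from E U = {e \<in> topspace (edges E). src E e \<in> U}"
    "edges_from F (\<phi> ` U) = {f \<in> topspace (edges F). src F f \<in> \<phi> ` U}"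
    by (simp_all only: edges_from_def)
  ultimately show thesis
    using that[OF U(1,2), of g] g(1) by (simp only:)
qed

lemma locally_conjugate_of_isomorphism: "locally_conjugate E F"
  unfolding locally_conjugate_def
proof (rule exI[of _ \<phi>], rule conjI[OF \<phi>], rule ballI)
  fix v assume v: "v \<in> topspace (verts E)"
  show "\<exists>U \<phi>1. U \<subseteq> topspace (verts E) \<and> v \<in> verts E interior_of U \<and>
      homeomorphic_map (subtopology (edges E) (edges_from E U))
        (subtopology (edges F) (edges_from F (\<phi> ` U))) \<phi>1 \<and>
      (\<forall>e\<in>edges_from E U. rng F (\<phi>1 e) = \<phi> (rng E e) \<and> src F (\<phi>1 e) = \<phi> (src E e))"
  proof (rule exists_local_edge_homeomorphism[OF v])
    fix U g
    assume U: "openin (verts E) U" "v \<in> U"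
      and g: "homeomorphic_map (subtopology (edges E) (edges_from E U))
        (subtopology (edges F) (edges_from F (\<phi> ` U))) g"
        "\<And>e. e \<in> edges_from E U \<Longrightarrow> rng F (g e) = \<phi> (rng E e) \<and> src F (g e) = \<phi> (src E e)"
    have "U \<subseteq> topspace (verts E)" "v \<in> verts E interior_of U"
      using U by (simp_all add: openin_subset interior_of_openin)
    with g show ?thesis
      by (intro exI[of _ U] exI[of _ g] conjI ballI) simp_all
  qed
qed

end

section \<open>From the bimodule isomorphism to its pointwise form\<close>

theorem theorem4p5:
  fixes E :: "('v, 'e) top_graph" and F :: "('w, 'f) top_graph"
  assumes "compact_topological_graph E" and "compact_topological_graph F"
    and "hilbert_bimod_isomorphic (graph_correspondence E) (graph_correspondence F)"
  shows "locally_conjugate E F"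
proof -
  note EG = compact_graph_facts[OF assms(1)] and FG = compact_graph_facts[OF assms(2)]
  obtain \<theta>0 \<theta>1 where iso: "star_isomorphism (cont_alg (verts E)) (cont_alg (verts F)) \<theta>0"
    and lin: "linear_bijection (graph_correspondence E) (graph_correspondence F) \<theta>1"
    and left: "\<forall>a\<in>cont_funs (verts E). \<forall>x\<in>cont_funs (edges E).
      \<theta>1 (\<lambda>e\<in>topspace (edges E). a (rng E e) * x e) =
      (\<lambda>f\<in>topspace (edges F). \<theta>0 a (rng F f) * \<theta>1 x f)"
    and inner: "\<forall>x\<in>cont_funs (edges E). \<forall>y\<in>cont_funs (edges E).
      (\<lambda>w\<in>topspace (verts F). \<Sum>f\<in>{f \<in> topspace (edges F). src F f = w}. cnj (\<theta>1 x f) * \<theta>1 y f) =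
      \<theta>0 (\<lambda>v\<in>topspace (verts E). \<Sum>e\<in>{e \<in> topspace (edges E). src E e = v}. cnj (x e) * y e)"
    using assms(3) unfolding hilbert_bimod_isomorphic_def
    by (elim exE conjE) (simp add: graph_correspondence_def cont_alg_def)
  obtain \<phi> where \<phi>: "homeomorphic_map (verts E) (verts F) \<phi>"
    "\<And>a v. a \<in> cont_funs (verts E) \<Longrightarrow> v \<in> topspace (verts E) \<Longrightarrow> \<theta>0 a (\<phi> v) = a v"
    by (rule star_iso_homeomorphism[OF iso EG(1,2) FG(1,2)]) auto
  show ?thesis
  proof (rule locally_conjugate_of_isomorphism[OF assms(1,2) \<phi>(1), of \<theta>1])
    show "bij_betw \<theta>1 (cont_funs (edges E)) (cont_funs (edges F))"
      using lin by (simp add: linear_bijection_def graph_correspondence_def)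
    show "\<theta>1 (\<lambda>e\<in>topspace (edges E). x e + y e) f = \<theta>1 x f + \<theta>1 y f"
      if "x \<in> cont_funs (edges E)" "y \<in> cont_funs (edges E)" "f \<in> topspace (edges F)" for x y f
      using lin that by (simp add: linear_bijection_def graph_correspondence_def)
    show "\<theta>1 (\<lambda>e\<in>topspace (edges E). c * x e) f = c * \<theta>1 x f"
      if "x \<in> cont_funs (edges E)" "f \<in> topspace (edges F)" for c x f
      using lin that by (simp add: linear_bijection_def graph_correspondence_def)
    show "\<theta>1 (\<lambda>e\<in>topspace (edges E). a (rng E e) * x e) f = a v * \<theta>1 x f"
      if "a \<in> cont_funs (verts E)" "x \<in> cont_funs (edges E)" "f \<in> topspace (edges F)"
        "v \<in> topspace (verts E)" "rng F f = \<phi> v" for a x f v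
      using left[rule_format, OF that(1,2)] \<phi>(2)[OF that(1,4)] that(3,5) by simp
    show "(\<Sum>f\<in>{f \<in> topspace (edges F). src F f = \<phi> v}. cnj (\<theta>1 x f) * \<theta>1 x f) =
        (\<Sum>e\<in>{e \<in> topspace (edges E). src E e = v}. cnj (x e) * x e)"
      if x: "x \<in> cont_funs (edges E)" and v: "v \<in> topspace (verts E)" for x v
    proof -
      \<comment> \<open>The coefficient isomorphism is known to be composition with the inverse of
        \<phi> only on continuous functions, so the inner product \<open>?i\<close> must first be
        shown continuous.\<close>
      let ?i = "\<lambda>v\<in>topspace (verts E). \<Sum>e\<in>{e \<in> topspace (edges E). src E e = v}. cnj (x e) * x e"
      have "?i \<in> cont_funs (verts E)"
        using x by (intro restrict_in_cont_funs continuous_map_fibre_sum[OF EG(3,4,2,6)]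
            continuous_intros cont_funs_continuous)
      moreover have "\<phi> v \<in> topspace (verts F)"
        using v homeomorphic_imp_surjective_map[OF \<phi>(1)] by blast
      ultimately show ?thesis
        using fun_cong[OF inner[rule_format, OF x x], of "\<phi> v"] \<phi>(2)[of ?i v] v by simp
    qed
  qed
qed

end
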